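(* Consider the linear minimization oracle $O(\Lambda)\coloneqq\arg\min_{\Sigma}\{\langle\Lambda,\Sigma\rangle:\Sigma\in\mathbb{B}\}$ for a given $\widehat\Sigma\succ0$, where the distance function is the Kullback-Leibler divergence, i.e. $\mathbb{B}\coloneqq\{\Sigma\succeq0:\mathrm{KL}(\Sigma\|\widehat\Sigma)\le\varepsilon\}$. (i) (Closed-form description) For any symmetric matrix $\Lambda$ and a positive scalar $\gamma$, define $$\Sigma^\star(\Lambda,\gamma)\coloneqq\Big(\widehat\Sigma^{-1}+\frac{2}{\gamma}\Lambda\Big)^{-1}.$$ Then $O(\Lambda)$ equates to $\Sigma^\star(\Lambda,\gamma^\star)$, where the scalar $\gamma^\star$ satisfies $$\mathrm{KL}\big(\Sigma^\star(\Lambda,\gamma^\star)\,\|\,\widehat\Sigma\big)-\varepsilon=0$$ and $$\max\Big\{0,\,2\lambda_{\max}\big(-\widehat\Sigma^{\frac12}\Lambda\widehat\Sigma^{\frac12}\big)\Big\}<\gamma^\star\le\big\|\widehat\Sigma^{\frac12}\Lambda\widehat\Sigma^{\frac12}\big\|_\ast\Big(\sqrt{\tfrac{6}{\varepsilon}}\,\mathbb{1}_{[0,\frac1{24}]}+\big(6+\tfrac{1}{4\varepsilon}\big)\mathbb{1}_{(\frac1{24},\infty)}\Big).$$ (ii) (Lipschitz constant) The Lipschitz constant $\mathcal{L}\coloneqq\max_{\Sigma\in\mathbb{B}}\|\Sigma\|_F$ (with respect to $\|\cdot\|_F$) of the dual function $g(\Lambda)\coloneqq\min_{\Sigma\in\mathbb{B}}\langle\Lambda,\Sigma\rangle$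 is bounded by $$\mathcal{L}\le\Big(n\sqrt{6\varepsilon}\,\mathbb{1}_{[0,\frac1{24}]}+n\big(6\varepsilon+\tfrac14\big)\mathbb{1}_{(\frac1{24},\infty)}+1\Big)\|\widehat\Sigma\|_F .$$
   Context: All matrices are real symmetric $n\times n$. $\widehat\Sigma$ is a given (empirical covariance) matrix and $\varepsilon$ is the radius of the ball $\mathbb{B}$. $\langle A,B\rangle=\operatorname{Tr}(A^\top B)$; $\|\cdot\|_F$ and $\|\cdot\|_\ast$ are the Frobenius and nuclear norms; $\lambda_{\max}$ is the largest eigenvalue. $\mathbb{1}_{A}$ is the indicator function of the set $A$ (equal to $1$ on $A$ and $0$ elsewhere), evaluated throughout at $\varepsilon$. The Kullback-Leibler divergence (between two normal distributions with identical means and covariances $\Sigma$, $\widehat\Sigma$) is $$\mathrm{KL}(\Sigma\|\widehat\Sigma)\coloneqq\tfrac12\big(-\log\det\Sigma+\log\det\widehat\Sigma+\operatorname{Tr}(\Sigma\widehat\Sigma^{-1})-n\big).$$ In this setting the underlying data vector $\xi=\Phi\alpha+\omega$ (with loading matrix $\Phi$), the factor vector $\alpha$ and the noise $\omega$ are assumed Gaussian. If the oracle problem has several optimizers, $O(\Lambda)$ denotes an arbitrary selection among them.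
   Formalization: In (i), Λ ≠ 0 and ε > 0 are assumed: for Λ = 0 the range for γ* is empty (0 < γ* ≤ 0), and for ε = 0 the upper bound √(6/ε) is undefined and KL(Σ*‖Σ̂) = 0 has no solution when Λ ≠ 0. *)

theory Defs
  imports "HOL-Analysis.Analysis"
begin

definition symmetric_matrix :: "real^'n^'n \<Rightarrow> bool" where
  "symmetric_matrix A \<longleftrightarrow> transpose A = A"

definition pos_semidef :: "real^'n^'n \<Rightarrow> bool" where
  "pos_semidef A \<longleftrightarrow> symmetric_matrix A \<and> (\<forall>x. 0 \<le> x \<bullet> (A *v x))"

definition pos_def :: "real^'n^'n \<Rightarrow> bool" where
  "pos_def A \<longleftrightarrow> symmetric_matrix A \<and> (\<forall>x. x \<noteq> 0 \<longrightarrow> 0 < x \<bullet> (A *v x))"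

text \<open>The principal square root; meaningful for positive semidefinite arguments only.\<close>

definition matrix_sqrt :: "real^'n^'n \<Rightarrow> real^'n^'n" where
  "matrix_sqrt A = (THE B. pos_semidef B \<and> B ** B = A)"

definition eigenvalues :: "real^'n^'n \<Rightarrow> real set" where
  "eigenvalues A = {k. \<exists>v. v \<noteq> 0 \<and> A *v v = k *\<^sub>R v}"

definition lambda_max :: "real^'n^'n \<Rightarrow> real" where
  "lambda_max A = Max (eigenvalues A)"

text \<open>The sum of the singular values of \<open>A\<close>, which are the eigenvalues (with multiplicity)
  of the square root of \<open>A\<^sup>TA\<close>.\<close>

definition nuclear_norm :: "real^'n^'n \<Rightarrow> real" where
  "nuclear_norm A = trace (matrix_sqrt (transpose A ** A))"

definition frob_inner :: "real^'n^'n \<Rightarrow> real^'n^'n \<Rightarrow> real" where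
  "frob_inner A B = trace (transpose A ** B)"

text \<open>The library's inner product and norm on \<^typ>\<open>real^'n^'n\<close> are the trace inner product
  and the Frobenius norm, so \<^const>\<open>norm\<close> is used for the latter, and
  \<^const>\<open>lipschitz_on\<close> refers to it.\<close>

lemma frob_inner_eq_inner: "frob_inner A B = A \<bullet> B"
  unfolding frob_inner_def trace_def matrix_matrix_mult_def transpose_def inner_vec_def
  by (simp, rule sum.swap)

lemma norm_eq_frobenius:
  fixes A :: "real^'n^'n"
  shows "norm A = sqrt (\<Sum>i\<in>UNIV. \<Sum>j\<in>UNIV. (A $ i $ j)\<^sup>2)"
  by (simp add: norm_eq_sqrt_inner inner_vec_def power2_eq_square)

text \<open>Extended-real valued: \<open>- log det S\<close> is \<open>\<infinity>\<close> for singular positive semidefinite \<open>S\<close>,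
  whereas the library has \<open>ln 0 = 0\<close>.\<close>

definition kl_div :: "real^'n^'n \<Rightarrow> real^'n^'n \<Rightarrow> ereal" where
  "kl_div S Sh =
     (if 0 < det S
      then ereal (1/2 * (- ln (det S) + ln (det Sh) + trace (S ** matrix_inv Sh) - real CARD('n)))
      else \<infinity>)"

definition kl_ball :: "real^'n^'n \<Rightarrow> real \<Rightarrow> (real^'n^'n) set" where
  "kl_ball Sh \<epsilon> = {S. pos_semidef S \<and> kl_div S Sh \<le> ereal \<epsilon>}"

text \<open>The set of all optimizers of the linear minimization problem over the ball.\<close>

definition lin_min :: "real^'n^'n \<Rightarrow> real \<Rightarrow> real^'n^'n \<Rightarrow> (real^'n^'n) set" where
  "lin_min Sh \<epsilon> L = {S. is_arg_min (\<lambda>T. frob_inner L T) (\<lambda>T. T \<in> kl_ball Sh \<epsilon>) S}"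

definition sigma_star :: "real^'n^'n \<Rightarrow> real^'n^'n \<Rightarrow> real \<Rightarrow> real^'n^'n" where
  "sigma_star Sh L \<gamma> = matrix_inv (matrix_inv Sh + (2/\<gamma>) *\<^sub>R L)"

text \<open>The next two are a minimum and a maximum whenever these are attained; as infima and suprema
  of sets of reals they carry no information otherwise.\<close>

definition dual_fun :: "real^'n^'n \<Rightarrow> real \<Rightarrow> real^'n^'n \<Rightarrow> real" where
  "dual_fun Sh \<epsilon> L = (INF S\<in>kl_ball Sh \<epsilon>. frob_inner L S)"

definition lip_const :: "real^'n^'n \<Rightarrow> real \<Rightarrow> real" where
  "lip_const Sh \<epsilon> = (SUP S\<in>kl_ball Sh \<epsilon>. norm S)"

end

theory Submission
  imports Defs
begin

text \<open>Let \<open>R\<close> be the square root of \<open>Sh\<close> and write a matrix as \<open>S = R Y R\<close>. The divergence of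
  \<open>S\<close> depends only on the eigenvalues \<open>y\<^sub>i\<close> of \<open>Y\<close>: it is half the sum of the terms
  \<open>y\<^sub>i - 1 - ln y\<^sub>i\<close> (\<open>kl_div_congruence\<close>), which are nonnegative and vanish only at \<open>1\<close>.
  This rests on the spectral theorem for real symmetric matrices, which also provides
  square roots and evaluates the nuclear norm and the largest eigenvalue.

  For the closed form, the Lagrangian of the problem with multiplier \<open>\<gamma>\<close> is an affine
  image of \<open>S \<mapsto> tr (A S) - ln det S\<close> with \<open>A = Sh\<^sup>-\<^sup>1 + (2/\<gamma>) \<Lambda>\<close>. If \<open>A\<close> is positive
  definite, this function has the unique minimiser \<open>A\<^sup>-\<^sup>1 = \<Sigma>\<^sup>\<star>(\<Lambda>, \<gamma>)\<close>
  (\<open>trace_ln_det_bound\<close>), so \<open>\<Sigma>\<^sup>\<star>\<close> is the only optimiser as soon as it lies on the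
  boundary of the ball (\<open>lin_min_eq_sigma_star\<close>). With \<open>m\<^sub>i\<close> the eigenvalues of \<open>R \<Lambda> R\<close>,
  the corresponding \<open>y\<^sub>i\<close> are \<open>1 / (1 + 2 m\<^sub>i / \<gamma>)\<close>. The divergence is then an explicit
  continuous function of \<open>\<gamma>\<close>, at most \<open>\<epsilon>\<close> for \<open>\<gamma>\<close> at the claimed upper bound and unbounded
  for \<open>\<gamma>\<close> tending to the claimed lower bound, so a multiplier exists by the intermediate
  value theorem (\<open>burg_multiplier_exists\<close>).

  For the Lipschitz constant, membership in the ball forces \<open>y\<^sub>i - 1 - ln y\<^sub>i \<le> 2 \<epsilon>\<close> for
  each \<open>i\<close>. This bounds each \<open>y\<^sub>i\<close> by an explicit \<open>k\<close>, so that \<open>0 \<le> S \<le> k Sh\<close> and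
  \<open>\<parallel>S\<parallel> \<le> k \<parallel>Sh\<parallel>\<close> (\<open>kl_ball_norm_bound\<close>). In particular the ball is compact, so all extrema
  are attained. The dual function is an infimum of linear functions with gradients in the
  ball, hence Lipschitz with the maximal norm as constant; the constant is optimal because
  the dual function drops at exactly that rate from \<open>0\<close> to minus a point of maximal norm
  (\<open>lip_const_le_lipschitz\<close>).\<close>

section \<open>The spectral theorem for real symmetric matrices\<close>

lemma symmetric_matrix_inner:
  fixes A :: "real^'n^'n"
  assumes "symmetric_matrix A"
  shows "x \<bullet> (A *v y) = (A *v x) \<bullet> y"
  using assms dot_lmul_matrix[of x A y] transpose_matrix_vector[of A x]
  by (simp add: symmetric_matrix_def)

text \<open>The eigenvector is a maximiser \<open>v\<close> of the quadratic form on the unit sphere of \<open>V\<close>, and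
  the eigenvalue \<open>k\<close> is the maximum. The form \<open>q w = k (w \<bullet> w) - w \<bullet> A w\<close> is then
  nonnegative on \<open>V\<close> and vanishes at \<open>v\<close>, so its first variation at \<open>v\<close> is zero in every
  direction of \<open>V\<close>; the residual \<open>u = k v - A v\<close> is such a direction, because \<open>V\<close> is
  invariant, and the variation along it is \<open>2 (u \<bullet> u)\<close>.\<close>

lemma symmetric_eigenvector_in_invariant_subspace:
  fixes A :: "real^'n^'n"
  assumes sym: "symmetric_matrix A" and V: "subspace V" and nz: "x \<in> V" "x \<noteq> 0"
    and inv: "\<And>x. x \<in> V \<Longrightarrow> A *v x \<in> V"
  obtains v k where "v \<in> V" "norm v = 1" "A *v v = k *\<^sub>R v"
proof -
  let ?S = "sphere 0 1 \<inter> V"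
  have "compact ?S"
    by (simp add: closed_subspace V compact_Int_closed)
  moreover have "(1 / norm x) *\<^sub>R x \<in> ?S"
    using nz V by (simp add: subspace_scale)
  moreover have "continuous_on ?S (\<lambda>x. x \<bullet> (A *v x))"
    by (intro continuous_intros)
  ultimately obtain v where v: "v \<in> ?S" and max: "\<And>w. w \<in> ?S \<Longrightarrow> w \<bullet> (A *v w) \<le> v \<bullet> (A *v v)"
    by (metis (no_types, lifting) continuous_attains_sup empty_iff)
  define k where "k = v \<bullet> (A *v v)"
  define q where "q w = k * (w \<bullet> w) - w \<bullet> (A *v w)" for w
  have vV: "v \<in> V" and v1: "norm v = 1" using v by auto
  have q_nonneg: "0 \<le> q w" if "w \<in> V" for w
  proof (cases "w = 0")
    case False
    define c where "c = 1 / norm w"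
    have "c *\<^sub>R w \<in> ?S" using that V False by (simp add: c_def subspace_scale)
    from max[OF this] have "c\<^sup>2 * (w \<bullet> (A *v w)) \<le> k"
      by (simp add: k_def matrix_vector_mult_scaleR power2_eq_square mult.assoc)
    moreover have "w \<bullet> w * c\<^sup>2 = 1" using False by (simp add: c_def power_divide dot_square_norm)
    ultimately have "w \<bullet> (A *v w) \<le> k * (w \<bullet> w)"
      using mult_right_mono[of "c\<^sup>2 * (w \<bullet> (A *v w))" k "w \<bullet> w"]
      by (simp add: mult.commute[of _ "w \<bullet> w"] flip: mult.assoc)
    then show ?thesis by (simp add: q_def)
  qed (simp add: q_def)
  define u where "u = k *\<^sub>R v - A *v v"
  have uV: "u \<in> V" unfolding u_def using V vV inv by (simp add: subspace_diff subspace_scale)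
  have q_line: "q (v + t *\<^sub>R u) = 2 * t * (u \<bullet> u) + t\<^sup>2 * q u" for t
  proof -
    have "v \<bullet> v = 1" using v1 by (simp add: norm_eq_1)
    moreover have "v \<bullet> (A *v u) = u \<bullet> (A *v v)"
      using symmetric_matrix_inner[OF sym, of v u] by (simp add: inner_commute)
    moreover have "u \<bullet> (A *v v) = k * (u \<bullet> v) - u \<bullet> u"
      by (subst (4) u_def) (simp add: inner_diff_right)
    ultimately have "k * (v \<bullet> v) - v \<bullet> (A *v v) = 0"
        "2 * k * (u \<bullet> v) - u \<bullet> (A *v v) - v \<bullet> (A *v u) = 2 * (u \<bullet> u)"
      by (simp_all add: k_def)
    moreover have "q (v + t *\<^sub>R u) = (k * (v \<bullet> v) - v \<bullet> (A *v v))
        + t * (2 * k * (u \<bullet> v) - u \<bullet> (A *v v) - v \<bullet> (A *v u)) + t\<^sup>2 * q u"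
      by (simp add: q_def matrix_vector_right_distrib matrix_vector_mult_scaleR
          inner_add_left inner_add_right inner_commute[of v u] algebra_simps power2_eq_square)
    ultimately show ?thesis by simp
  qed
  have "u = 0"
  proof (rule ccontr)
    assume "u \<noteq> 0"
    then have a: "u \<bullet> u > 0" by simp
    have qu: "q u \<ge> 0" by (rule q_nonneg[OF uV])
    \<comment> \<open>a step against the slope, short enough for the linear term to dominate; the \<open>+ 1\<close> covers \<open>q u = 0\<close>\<close>
    define t where "t = - (u \<bullet> u) / (q u + 1)"
    have t: "t < 0" using a qu by (simp add: t_def divide_neg_pos)
    have "t * q u \<ge> - (u \<bullet> u)"
      using a qu by (simp add: t_def field_simps)
    then have "2 * (u \<bullet> u) + t * q u > 0" using a by linarith
    then have "t * (2 * (u \<bullet> u) + t * q u) < 0" using t by (rule mult_neg_pos[rotated])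
    moreover have "v + t *\<^sub>R u \<in> V" using V vV uV by (simp add: subspace_add subspace_scale)
    ultimately show False
      using q_nonneg[of "v + t *\<^sub>R u"] by (simp add: q_line algebra_simps power2_eq_square)
  qed
  then have "A *v v = k *\<^sub>R v" by (simp add: u_def)
  then show thesis using vV v1 that by blast
qed

definition diag_matrix :: "('n \<Rightarrow> real) \<Rightarrow> real^'n^'n" where
  "diag_matrix d = (\<chi> i j. if i = j then d i else 0)"

text \<open>Among the orthonormal sets of eigenvectors one has maximal cardinality. Its orthogonal
  complement is invariant, by symmetry, so a nonzero complement would contain a further
  eigenvector. Hence the set is an orthonormal basis, and its elements are the columns of
  \<open>P\<close>.\<close>

lemma spectral_theorem:
  fixes A :: "real^'n^'n"
  assumes sym: "symmetric_matrix A"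
  obtains P d where "orthogonal_matrix P" "A = P ** diag_matrix d ** transpose P"
proof -
  define good where "good E \<longleftrightarrow> pairwise orthogonal E \<and>
      (\<forall>e\<in>E. norm e = 1 \<and> (\<exists>k. A *v e = k *\<^sub>R e))" for E :: "(real^'n) set"
  have indep: "independent E" if "good E" for E
  proof (rule pairwise_orthogonal_independent)
    show "0 \<notin> E" using that by (auto simp: good_def)
  qed (use that good_def in blast)
  have "good {}" by (simp add: good_def)
  moreover have "\<forall>E. good E \<longrightarrow> card E < Suc CARD('n)"
    using independent_bound[OF indep] by (simp add: less_Suc_eq_le)
  ultimately have "\<exists>E. good E \<and> (\<forall>F. good F \<longrightarrow> card F \<le> card E)"
    by (rule ex_has_greatest_nat)
  then obtain E where E: "good E" and maxE: "\<And>F. good F \<Longrightarrow> card F \<le> card E"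
    by auto
  have finE: "finite E" using independent_bound[OF indep[OF E]] by simp
  have spanE: "span E = UNIV"
  proof (rule ccontr)
    assume "span E \<noteq> UNIV"
    then obtain a where a: "a \<noteq> 0" "\<And>x. x \<in> span E \<Longrightarrow> a \<bullet> x = 0"
      using span_not_UNIV_orthogonal[of E] by blast
    define V where "V = {x. \<forall>e\<in>E. e \<bullet> x = 0}"
    have "subspace V" by (auto simp: V_def subspace_def inner_add_right)
    moreover have "a \<in> V" using a(2) by (auto simp: V_def inner_commute span_base)
    moreover have "A *v x \<in> V" if "x \<in> V" for x
      unfolding V_def
    proof (clarify)
      fix e assume "e \<in> E"
      then obtain k where "A *v e = k *\<^sub>R e" using E by (auto simp: good_def)
      then show "e \<bullet> (A *v x) = 0"
        using that \<open>e \<in> E\<close> by (simp add: symmetric_matrix_inner[OF sym] V_def)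
    qed
    ultimately obtain v k where v: "v \<in> V" "norm v = 1" "A *v v = k *\<^sub>R v"
      using symmetric_eigenvector_in_invariant_subspace[OF sym _ _ a(1)] by metis
    have "v \<notin> E"
    proof
      assume "v \<in> E"
      then have "v \<bullet> v = 0" using v(1) by (auto simp: V_def)
      then show False using v(2) by simp
    qed
    have "good (insert v E)"
      using E v unfolding good_def pairwise_insert
      by (auto simp: V_def orthogonal_def inner_commute)
    from maxE[OF this] show False using \<open>v \<notin> E\<close> finE by simp
  qed
  have "card E = CARD('n)"
    using dim_eq_card_independent[OF indep[OF E]] dim_span[of E] spanE by (simp add: dim_UNIV)
  then obtain f :: "'n \<Rightarrow> real^'n" where f: "bij_betw f UNIV E"
    using finite_same_card_bij[of "UNIV :: 'n set" E] finE by auto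
  have fE: "f j \<in> E" for j using f by (auto simp: bij_betw_def)
  have "\<exists>d. \<forall>j. A *v f j = d j *\<^sub>R f j"
    using E fE by (intro choice) (auto simp: good_def)
  then obtain d where d: "\<And>j. A *v f j = d j *\<^sub>R f j" by blast
  define P where "P = (\<chi> i j. f j $ i)"
  have col: "column j P = f j" for j by (simp add: P_def column_def)
  have P: "orthogonal_matrix P"
    unfolding orthogonal_matrix_orthonormal_columns col
  proof (intro conjI allI impI)
    show "norm (f i) = 1" for i using E fE by (auto simp: good_def)
    show "orthogonal (f i) (f j)" if "i \<noteq> j" for i j
      using E fE[of i] fE[of j] that f unfolding good_def pairwise_def bij_betw_def
      by (metis UNIV_I inj_onD)
  qed
  have "A ** P = P ** diag_matrix d"
  proof -
    have "(A ** P) $ i $ j = (P ** diag_matrix d) $ i $ j" for i j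
    proof -
      have "(A ** P) $ i $ j = (A *v f j) $ i"
        by (simp add: matrix_matrix_mult_def matrix_vector_mult_def P_def)
      also have "\<dots> = d j * f j $ i" by (simp add: d)
      also have "\<dots> = (P ** diag_matrix d) $ i $ j"
        by (simp add: matrix_matrix_mult_def P_def diag_matrix_def if_distrib cong: if_cong)
      finally show ?thesis .
    qed
    then show ?thesis by (simp add: vec_eq_iff)
  qed
  then have "A = P ** diag_matrix d ** transpose P"
    using P by (metis matrix_mul_assoc matrix_mul_rid orthogonal_matrix_def)
  with P show thesis by (rule that)
qed

section \<open>Matrices diagonalised by a fixed orthogonal matrix\<close>

text \<open>For fixed orthogonal \<open>P\<close> these matrices form a copy of the algebra of real functions on
  the index type: products, sums, inverses and square roots of the matrices act entrywise
  on \<open>d\<close>.\<close>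

definition spectral_matrix :: "real^'n^'n \<Rightarrow> ('n \<Rightarrow> real) \<Rightarrow> real^'n^'n" where
  "spectral_matrix P d = P ** diag_matrix d ** transpose P"

lemma diag_matrix_mult: "diag_matrix a ** diag_matrix b = diag_matrix (\<lambda>i. a i * b i)"
proof -
  have "(if i = k then a i else 0) * (if k = j then b k else 0)
      = (if i = k then if i = j then a i * b i else 0 else 0)" for i j k
    by auto
  then show ?thesis by (simp add: diag_matrix_def matrix_matrix_mult_def vec_eq_iff)
qed

lemma diag_matrix_mult_vector_nth: "(diag_matrix d *v x) $ i = d i * x $ i"
proof -
  have "(if i = j then d i else 0) * x $ j = (if i = j then d i * x $ i else 0)" for j
    by auto
  then show ?thesis by (simp add: diag_matrix_def matrix_vector_mult_def)
qed

lemma transpose_diag_matrix: "transpose (diag_matrix d) = diag_matrix d"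
  by (simp add: diag_matrix_def transpose_def vec_eq_iff)

lemma orthogonal_matrix_cancel:
  fixes P :: "real^'n^'n"
  assumes "orthogonal_matrix P"
  shows "transpose P ** P = mat 1" "P ** transpose P = mat 1"
  using assms by (auto simp: orthogonal_matrix_def)

lemma spectral_matrix_mult:
  assumes "orthogonal_matrix P"
  shows "spectral_matrix P a ** spectral_matrix P b = spectral_matrix P (\<lambda>i. a i * b i)"
proof -
  have "spectral_matrix P a ** spectral_matrix P b
      = P ** diag_matrix a ** (transpose P ** P) ** diag_matrix b ** transpose P"
    by (simp add: spectral_matrix_def matrix_mul_assoc)
  also have "\<dots> = P ** (diag_matrix a ** diag_matrix b) ** transpose P"
    by (simp add: orthogonal_matrix_cancel[OF assms] matrix_mul_assoc)
  finally show ?thesis by (simp add: diag_matrix_mult spectral_matrix_def)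
qed

lemma diag_matrix_one: "diag_matrix (\<lambda>_. 1) = mat 1"
  by (simp add: diag_matrix_def mat_def)

lemma spectral_matrix_one:
  assumes "orthogonal_matrix P"
  shows "spectral_matrix P (\<lambda>_. 1) = mat 1"
  by (simp add: spectral_matrix_def diag_matrix_one orthogonal_matrix_cancel[OF assms])

lemma matrix_add_rdistrib:
  fixes A B :: "real^'n^'m"
  shows "(A + B) ** C = A ** C + B ** C"
  by (simp add: matrix_matrix_mult_def vec_eq_iff distrib_right sum.distrib)

lemma spectral_matrix_add:
  "spectral_matrix P a + spectral_matrix P b = spectral_matrix P (\<lambda>i. a i + b i)"
proof -
  have "diag_matrix (\<lambda>i. a i + b i) = diag_matrix a + diag_matrix b"
    by (simp add: diag_matrix_def vec_eq_iff)
  then show ?thesis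
    by (simp add: spectral_matrix_def matrix_add_ldistrib matrix_add_rdistrib)
qed

lemma spectral_matrix_scaleR:
  "c *\<^sub>R spectral_matrix P a = spectral_matrix P (\<lambda>i. c * a i)"
proof -
  have "diag_matrix (\<lambda>i. c * a i) = c *\<^sub>R diag_matrix a"
    by (simp add: diag_matrix_def vec_eq_iff)
  then show ?thesis
    by (simp add: spectral_matrix_def matrix_scalar_ac scalar_matrix_assoc)
qed

lemma spectral_matrix_uminus: "- spectral_matrix P a = spectral_matrix P (\<lambda>i. - a i)"
  using spectral_matrix_scaleR[of "-1" P a] by simp

lemma symmetric_spectral_matrix: "symmetric_matrix (spectral_matrix P d)"
  by (simp add: symmetric_matrix_def spectral_matrix_def matrix_transpose_mul
      transpose_diag_matrix matrix_mul_assoc)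

lemma trace_spectral_matrix:
  assumes "orthogonal_matrix P"
  shows "trace (spectral_matrix P d) = (\<Sum>i\<in>UNIV. d i)"
proof -
  have "trace (spectral_matrix P d) = trace (transpose P ** P ** diag_matrix d)"
    by (simp add: spectral_matrix_def trace_mul_sym[of _ "transpose P"] matrix_mul_assoc)
  then show ?thesis
    by (simp add: orthogonal_matrix_cancel[OF assms] trace_def diag_matrix_def)
qed

lemma det_spectral_matrix:
  assumes "orthogonal_matrix P"
  shows "det (spectral_matrix P d) = (\<Prod>i\<in>UNIV. d i)"
proof -
  have "det P * det (transpose P) = 1"
    by (metis assms det_I det_mul orthogonal_matrix_cancel(2))
  then have "det (spectral_matrix P d) = det (diag_matrix d)"
    by (simp add: spectral_matrix_def det_mul)
  also have "\<dots> = (\<Prod>i\<in>UNIV. d i)"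
    by (subst det_diagonal) (simp_all add: diag_matrix_def)
  finally show ?thesis .
qed

lemma spectral_matrix_mult_vector:
  "spectral_matrix P d *v x = P *v (diag_matrix d *v (transpose P *v x))"
  by (simp add: spectral_matrix_def matrix_vector_mul_assoc matrix_mul_assoc
      del: transpose_matrix_vector)

lemma spectral_matrix_eigenvector:
  assumes "orthogonal_matrix P"
  shows "spectral_matrix P d *v (P *v axis i 1) = d i *\<^sub>R (P *v axis i 1)"
    and "P *v axis i 1 \<noteq> 0" and "(P *v axis i 1) \<bullet> (P *v axis i 1) = 1"
proof -
  have cancel: "transpose P *v (P *v x) = x" for x
    by (metis assms matrix_vector_mul_assoc matrix_vector_mul_lid orthogonal_matrix_cancel(1))
  have "diag_matrix d *v axis i 1 = d i *\<^sub>R axis i 1"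
    by (simp add: vec_eq_iff diag_matrix_mult_vector_nth axis_def)
  then show "spectral_matrix P d *v (P *v axis i 1) = d i *\<^sub>R (P *v axis i 1)"
    by (simp only: spectral_matrix_mult_vector cancel matrix_vector_mult_scaleR)
  have "(P *v axis i 1) \<bullet> (P *v axis i 1) = (transpose P *v (P *v axis i 1)) \<bullet> axis i 1"
    by (simp add: dot_lmul_matrix)
  then show one: "(P *v axis i 1) \<bullet> (P *v axis i 1) = 1"
    by (simp only: cancel) (simp add: inner_axis)
  then show "P *v axis i 1 \<noteq> 0" by auto
qed

lemma quadratic_form_spectral_matrix:
  "x \<bullet> (spectral_matrix P d *v x) = (\<Sum>i\<in>UNIV. d i * ((transpose P *v x) $ i)\<^sup>2)"
proof -
  have "x \<bullet> (spectral_matrix P d *v x) = (transpose P *v x) \<bullet> (diag_matrix d *v (transpose P *v x))"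
    by (simp add: spectral_matrix_mult_vector dot_lmul_matrix)
  also have "\<dots> = (\<Sum>i\<in>UNIV. d i * ((transpose P *v x) $ i)\<^sup>2)"
    unfolding inner_vec_def diag_matrix_mult_vector_nth
    by (simp add: power2_eq_square ac_simps)
  finally show ?thesis .
qed

lemma pos_semidef_spectral_matrix:
  assumes P: "orthogonal_matrix P"
  shows "pos_semidef (spectral_matrix P d) \<longleftrightarrow> (\<forall>i. 0 \<le> d i)"
proof
  assume psd: "pos_semidef (spectral_matrix P d)"
  show "\<forall>i. 0 \<le> d i"
  proof
    fix i
    have "0 \<le> (P *v axis i 1) \<bullet> (spectral_matrix P d *v (P *v axis i 1))"
      using psd by (simp add: pos_semidef_def)
    then show "0 \<le> d i" by (simp add: spectral_matrix_eigenvector[OF P])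
  qed
qed (auto simp: pos_semidef_def symmetric_spectral_matrix quadratic_form_spectral_matrix
    intro!: sum_nonneg simp del: transpose_matrix_vector)

lemma pos_def_spectral_matrix:
  assumes P: "orthogonal_matrix P"
  shows "pos_def (spectral_matrix P d) \<longleftrightarrow> (\<forall>i. 0 < d i)"
proof
  assume pd: "pos_def (spectral_matrix P d)"
  show "\<forall>i. 0 < d i"
  proof
    fix i
    have "0 < (P *v axis i 1) \<bullet> (spectral_matrix P d *v (P *v axis i 1))"
      using pd spectral_matrix_eigenvector(2)[OF P] unfolding pos_def_def by blast
    then show "0 < d i" by (simp add: spectral_matrix_eigenvector[OF P])
  qed
next
  assume d: "\<forall>i. 0 < d i"
  have "0 < x \<bullet> (spectral_matrix P d *v x)" if "x \<noteq> 0" for x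
  proof -
    have "transpose P *v x \<noteq> 0"
      by (metis P matrix_vector_mul_assoc matrix_vector_mul_lid matrix_vector_mult_0_right
          orthogonal_matrix_cancel(2) that)
    then obtain i where "(transpose P *v x) $ i \<noteq> 0" by (metis vec_eq_iff zero_index)
    then have "0 < (\<Sum>i\<in>UNIV. d i * ((transpose P *v x) $ i)\<^sup>2)"
      using d by (intro sum_pos2[of _ i]) (auto simp: less_imp_le simp del: transpose_matrix_vector)
    then show ?thesis by (simp only: quadratic_form_spectral_matrix)
  qed
  then show "pos_def (spectral_matrix P d)"
    by (simp add: pos_def_def symmetric_spectral_matrix)
qed

text \<open>If \<open>v\<close> is an eigenvector, \<open>w = P\<^sup>T v\<close> is one of the diagonal matrix, and any nonzero
  coordinate of \<open>w\<close> identifies the eigenvalue.\<close>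

lemma eigenvalues_spectral_matrix:
  assumes P: "orthogonal_matrix P"
  shows "eigenvalues (spectral_matrix P d) = range d"
proof
  show "range d \<subseteq> eigenvalues (spectral_matrix P d)"
    using spectral_matrix_eigenvector[OF P] unfolding eigenvalues_def by blast
  show "eigenvalues (spectral_matrix P d) \<subseteq> range d"
  proof
    fix k assume "k \<in> eigenvalues (spectral_matrix P d)"
    then obtain v where v: "v \<noteq> 0" "spectral_matrix P d *v v = k *\<^sub>R v"
      by (auto simp: eigenvalues_def)
    define w where "w = transpose P *v v"
    have "P *v w = v"
      by (simp only: w_def matrix_vector_mul_assoc orthogonal_matrix_cancel[OF P] matrix_vector_mul_lid)
    then have "w \<noteq> 0" using v(1) by auto
    then obtain i where i: "w $ i \<noteq> 0" by (metis vec_eq_iff zero_index)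
    have "diag_matrix d *v w = (transpose P ** P) *v (diag_matrix d *v w)"
      by (simp add: orthogonal_matrix_cancel[OF P])
    also have "\<dots> = transpose P *v (spectral_matrix P d *v v)"
      by (simp only: spectral_matrix_mult_vector w_def matrix_vector_mul_assoc matrix_mul_assoc)
    also have "\<dots> = k *\<^sub>R w" by (simp only: v(2) matrix_vector_mult_scaleR w_def)
    finally have "d i * w $ i = k * w $ i"
      by (metis diag_matrix_mult_vector_nth real_scaleR_def vector_scaleR_component)
    then show "k \<in> range d" using i by auto
  qed
qed

lemma symmetric_matrix_spectral:
  fixes A :: "real^'n^'n"
  assumes "symmetric_matrix A"
  obtains P d where "orthogonal_matrix P" "A = spectral_matrix P d"
  using spectral_theorem[OF assms] unfolding spectral_matrix_def by metis

section \<open>Definiteness, square roots and congruence\<close>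

lemma matrix_inv_eqI:
  fixes A :: "real^'n^'n"
  assumes "A ** B = mat 1"
  shows "matrix_inv A = B"
proof -
  have "B ** A = mat 1" using assms matrix_left_right_inverse by blast
  then have "A ** matrix_inv A = mat 1"
    unfolding matrix_inv_def using assms by (metis (mono_tags, lifting) someI_ex)
  then show ?thesis by (metis \<open>B ** A = mat 1\<close> matrix_mul_assoc matrix_mul_lid matrix_mul_rid)
qed

text \<open>Let \<open>v\<close> be an eigenvector of \<open>B - C\<close> with eigenvalue \<open>k\<close>. As \<open>B\<^sup>2 = C\<^sup>2\<close>, the vectors
  \<open>B v\<close> and \<open>C v\<close> have the same length, so their difference \<open>k v\<close> is orthogonal to their
  sum: \<open>k (v \<bullet> B v + v \<bullet> C v) = 0\<close>. Either \<open>k = 0\<close>, or both nonnegative forms vanish at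
  \<open>v\<close>, which again gives \<open>k = 0\<close>. So the symmetric matrix \<open>B - C\<close> has only zero
  eigenvalues.\<close>

lemma pos_semidef_square_root_unique:
  fixes B :: "real^'n^'n"
  assumes B: "pos_semidef B" and C: "pos_semidef C" and eq: "B ** B = C ** C"
  shows "B = C"
proof -
  have sB: "symmetric_matrix B" and sC: "symmetric_matrix C"
    using B C by (auto simp: pos_semidef_def)
  have "transpose (B - C) = transpose B - transpose C"
    by (simp add: transpose_def vec_eq_iff)
  then have "symmetric_matrix (B - C)"
    using sB sC by (simp add: symmetric_matrix_def)
  then obtain P d where P: "orthogonal_matrix P" and Pd: "B - C = spectral_matrix P d"
    by (rule symmetric_matrix_spectral)
  have "d i = 0" for i
  proof -
    define v where "v = P *v axis i 1"
    have ev: "B *v v - C *v v = d i *\<^sub>R v"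
      using spectral_matrix_eigenvector(1)[OF P, of d i]
      by (simp add: Pd[symmetric] v_def matrix_vector_mult_diff_rdistrib)
    have "v \<bullet> (B *v (B *v v)) = v \<bullet> (C *v (C *v v))"
      by (simp add: matrix_vector_mul_assoc eq)
    then have "(B *v v) \<bullet> (B *v v) = (C *v v) \<bullet> (C *v v)"
      by (simp add: symmetric_matrix_inner[OF sB] symmetric_matrix_inner[OF sC])
    then have "0 = (B *v v - C *v v) \<bullet> (B *v v + C *v v)"
      by (simp add: inner_diff_left inner_diff_right inner_add_right inner_commute)
    also have "\<dots> = d i * (v \<bullet> (B *v v) + v \<bullet> (C *v v))"
      by (simp add: ev inner_add_right distrib_left)
    finally consider "d i = 0" | "v \<bullet> (B *v v) + v \<bullet> (C *v v) = 0" by auto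
    then show ?thesis
    proof cases
      case 2
      have "0 \<le> v \<bullet> (B *v v)" "0 \<le> v \<bullet> (C *v v)" using B C by (auto simp: pos_semidef_def)
      with 2 have "v \<bullet> (B *v v - C *v v) = 0" by (simp add: inner_diff_right)
      then show ?thesis
        unfolding ev using spectral_matrix_eigenvector(3)[OF P] by (simp add: v_def)
    qed
  qed
  \<comment> \<open>zero is written as a multiple because scaling is what turns it into the zero matrix\<close>
  then have "d = (\<lambda>i. 0 * 1)" by auto
  then have "B - C = spectral_matrix P (\<lambda>i. 0 * 1)" by (simp only: Pd)
  also have "\<dots> = 0" by (simp only: spectral_matrix_scaleR[symmetric] scaleR_zero_left)
  finally show ?thesis by simp
qed

lemma matrix_sqrt_eqI:
  assumes "pos_semidef B" "B ** B = A"
  shows "matrix_sqrt A = B"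
  unfolding matrix_sqrt_def
proof (rule the_equality)
  show "pos_semidef B \<and> B ** B = A" using assms by simp
  show "C = B" if "pos_semidef C \<and> C ** C = A" for C
    using that assms pos_semidef_square_root_unique[of C B] by simp
qed

lemma nuclear_norm_spectral_matrix:
  assumes P: "orthogonal_matrix P"
  shows "nuclear_norm (spectral_matrix P d) = (\<Sum>i\<in>UNIV. \<bar>d i\<bar>)"
proof -
  have "matrix_sqrt (transpose (spectral_matrix P d) ** spectral_matrix P d)
      = spectral_matrix P (\<lambda>i. \<bar>d i\<bar>)"
  proof (rule matrix_sqrt_eqI)
    show "pos_semidef (spectral_matrix P (\<lambda>i. \<bar>d i\<bar>))"
      by (simp add: pos_semidef_spectral_matrix[OF P])
    show "spectral_matrix P (\<lambda>i. \<bar>d i\<bar>) ** spectral_matrix P (\<lambda>i. \<bar>d i\<bar>)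
        = transpose (spectral_matrix P d) ** spectral_matrix P d"
      using symmetric_spectral_matrix[of P d]
      by (simp add: spectral_matrix_mult[OF P] symmetric_matrix_def)
  qed
  then show ?thesis by (simp add: nuclear_norm_def trace_spectral_matrix[OF P])
qed

lemma pos_semidef_matrix_sqrt:
  assumes "pos_semidef A"
  shows "pos_semidef (matrix_sqrt A)" "matrix_sqrt A ** matrix_sqrt A = A"
proof -
  have "symmetric_matrix A" using assms by (simp add: pos_semidef_def)
  then obtain P d where P: "orthogonal_matrix P" and A: "A = spectral_matrix P d"
    by (rule symmetric_matrix_spectral)
  have d: "\<forall>i. 0 \<le> d i" using assms by (simp add: A pos_semidef_spectral_matrix[OF P])
  let ?B = "spectral_matrix P (\<lambda>i. sqrt (d i))"
  have "pos_semidef ?B" "?B ** ?B = A"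
    using d by (simp_all add: A spectral_matrix_mult[OF P] pos_semidef_spectral_matrix[OF P])
  moreover from this have "matrix_sqrt A = ?B" by (rule matrix_sqrt_eqI)
  ultimately show "pos_semidef (matrix_sqrt A)" "matrix_sqrt A ** matrix_sqrt A = A"
    by simp_all
qed

text \<open>Nonnegative eigenvalues with a positive product are all positive. Thus finiteness of the
  divergence already forces a point of the ball to be positive definite.\<close>

lemma pos_def_iff_pos_semidef_det:
  fixes A :: "real^'n^'n"
  shows "pos_def A \<longleftrightarrow> pos_semidef A \<and> 0 < det A"
proof (cases "symmetric_matrix A")
  case True
  then obtain P d where P: "orthogonal_matrix P" and A: "A = spectral_matrix P d"
    by (rule symmetric_matrix_spectral)
  have "(\<forall>i. 0 < d i)" if "\<forall>i. 0 \<le> d i" "0 < (\<Prod>i\<in>UNIV. d i)"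
  proof
    fix i show "0 < d i" using that by (metis UNIV_I finite less_eq_real_def less_irrefl prod_zero)
  qed
  moreover have "0 < (\<Prod>i\<in>UNIV. d i)" if "\<forall>i. 0 < d i" using that by (simp add: prod_pos)
  ultimately show ?thesis
    by (auto simp: A pos_def_spectral_matrix[OF P] pos_semidef_spectral_matrix[OF P]
        det_spectral_matrix[OF P] less_imp_le)
qed (auto simp: pos_def_def pos_semidef_def)

lemma pos_def_inverse:
  fixes A :: "real^'n^'n"
  assumes "pos_def A"
  obtains "A ** matrix_inv A = mat 1" "matrix_inv A ** A = mat 1" "pos_def (matrix_inv A)"
proof -
  have "symmetric_matrix A" using assms by (simp add: pos_def_def)
  then obtain P d where P: "orthogonal_matrix P" and A: "A = spectral_matrix P d"
    by (rule symmetric_matrix_spectral)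
  have d: "0 < d i" for i using assms by (simp add: A pos_def_spectral_matrix[OF P])
  have inv: "A ** spectral_matrix P (\<lambda>i. 1 / d i) = mat 1"
    using d[THEN less_imp_neq] by (simp add: A spectral_matrix_mult[OF P] spectral_matrix_one[OF P])
  then have "matrix_inv A = spectral_matrix P (\<lambda>i. 1 / d i)" by (rule matrix_inv_eqI)
  then show thesis
    using that inv matrix_left_right_inverse d by (metis (mono_tags, lifting) P divide_pos_pos
        pos_def_spectral_matrix zero_less_one)
qed

lemma symmetric_matrix_congruence:
  assumes "symmetric_matrix A" "symmetric_matrix B"
  shows "symmetric_matrix (B ** A ** B)"
  using assms by (simp add: symmetric_matrix_def matrix_transpose_mul matrix_mul_assoc)

lemma pos_semidef_congruence:
  assumes "pos_semidef A" and "symmetric_matrix B"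
  shows "pos_semidef (B ** A ** B)"
proof -
  have "symmetric_matrix (B ** A ** B)"
    using assms by (simp add: pos_semidef_def symmetric_matrix_congruence)
  moreover have "0 \<le> x \<bullet> ((B ** A ** B) *v x)" for x
  proof -
    have "x \<bullet> ((B ** A ** B) *v x) = (B *v x) \<bullet> (A *v (B *v x))"
      by (simp add: symmetric_matrix_inner[OF assms(2), symmetric] matrix_vector_mul_assoc matrix_mul_assoc)
    then show ?thesis using assms(1) by (simp add: pos_semidef_def)
  qed
  ultimately show ?thesis by (simp add: pos_semidef_def)
qed

lemma pos_def_congruence:
  fixes A B :: "real^'n^'n"
  assumes A: "pos_def A" and B: "symmetric_matrix B" "det B \<noteq> 0"
  shows "pos_def (B ** A ** B)"
proof -
  have "0 < (det B)\<^sup>2 * det A"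
    using A B(2) by (simp add: pos_def_iff_pos_semidef_det)
  then have "0 < det (B ** A ** B)" by (simp add: det_mul power2_eq_square ac_simps)
  then show ?thesis
    using A B(1) by (simp add: pos_def_iff_pos_semidef_det pos_semidef_congruence)
qed

lemma pos_semidef_trace_nonneg:
  assumes "pos_semidef A"
  shows "0 \<le> trace A"
proof -
  have "symmetric_matrix A" using assms by (simp add: pos_semidef_def)
  then obtain P d where P: "orthogonal_matrix P" and A: "A = spectral_matrix P d"
    by (rule symmetric_matrix_spectral)
  then show ?thesis
    using assms by (simp add: pos_semidef_spectral_matrix trace_spectral_matrix sum_nonneg)
qed

text \<open>With \<open>R\<close> the square root of \<open>B\<close>, the inner product is the trace of \<open>R A R\<close>, which is
  positive semidefinite.\<close>

lemma inner_pos_semidef_nonneg: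
  fixes A B :: "real^'n^'n"
  assumes A: "pos_semidef A" and B: "pos_semidef B"
  shows "0 \<le> A \<bullet> B"
proof -
  let ?R = "matrix_sqrt B"
  have "A \<bullet> B = trace (A ** (?R ** ?R))"
    using A pos_semidef_matrix_sqrt[OF B]
    by (simp add: frob_inner_eq_inner[symmetric] frob_inner_def pos_semidef_def symmetric_matrix_def)
  also have "\<dots> = trace (?R ** A ** ?R)"
    by (metis matrix_mul_assoc trace_mul_sym)
  finally show ?thesis
    using pos_semidef_trace_nonneg[OF pos_semidef_congruence[OF A, of ?R]] pos_semidef_matrix_sqrt(1)[OF B]
    by (simp add: pos_semidef_def)
qed

lemma pos_def_matrix_sqrt_inverse:
  fixes A :: "real^'n^'n"
  assumes "pos_def A"
  obtains Q where "symmetric_matrix Q" "matrix_sqrt A ** Q = mat 1" "Q ** matrix_sqrt A = mat 1"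
    "matrix_inv A = Q ** Q" "det Q \<noteq> 0"
proof -
  let ?R = "matrix_sqrt A"
  have R: "pos_semidef ?R" "?R ** ?R = A"
    using pos_semidef_matrix_sqrt assms by (auto simp: pos_def_iff_pos_semidef_det)
  then have "0 < det ?R * det ?R" using assms by (metis det_mul pos_def_iff_pos_semidef_det)
  moreover have "0 \<le> det ?R"
  proof -
    have "symmetric_matrix ?R" using R by (simp add: pos_semidef_def)
    then obtain P d where P: "orthogonal_matrix P" and d: "?R = spectral_matrix P d"
      by (rule symmetric_matrix_spectral)
    then show ?thesis
      using R by (metis det_spectral_matrix pos_semidef_spectral_matrix prod_nonneg)
  qed
  ultimately have "pos_def ?R" using R by (auto simp: pos_def_iff_pos_semidef_det less_eq_real_def)
  then obtain Q where Q: "?R ** Q = mat 1" "Q ** ?R = mat 1" "pos_def Q"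
    using pos_def_inverse by blast
  have "A ** (Q ** Q) = ?R ** (?R ** Q) ** Q" by (simp add: matrix_mul_assoc R)
  also have "\<dots> = mat 1" by (simp add: Q)
  finally have "matrix_inv A = Q ** Q" by (rule matrix_inv_eqI)
  then show thesis using Q that by (auto simp: pos_def_iff_pos_semidef_det pos_semidef_def)
qed

text \<open>The cone is cut out by conditions that are continuous in the matrix: symmetry, and one
  inequality for each vector.\<close>

lemma closed_pos_semidef: "closed {S :: real^'n^'n. pos_semidef S}"
proof -
  have q: "continuous_on UNIV (\<lambda>S :: real^'n^'n. x \<bullet> (S *v x))" for x
    unfolding matrix_vector_mult_def inner_vec_def by (simp, intro continuous_intros)
  have tr: "continuous_on UNIV (transpose :: real^'n^'n \<Rightarrow> _)"
    unfolding transpose_def by (intro continuous_intros)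
  show ?thesis
    unfolding pos_semidef_def symmetric_matrix_def
    by (intro closed_Collect_conj closed_Collect_all closed_Collect_eq closed_Collect_le
        continuous_on_const continuous_on_id q tr)
qed

section \<open>Optimality through the Lagrangian\<close>

text \<open>The log-determinant barrier \<open>X \<mapsto> tr (A X) - ln det X\<close> has its unique minimum at \<open>A\<^sup>-\<^sup>1\<close>.
  Conjugation by the square root \<open>B\<close> of \<open>A\<close> turns \<open>A X\<close> into the symmetric matrix
  \<open>Y = B X B\<close> with the same trace and determinant; with its eigenvalues \<open>y\<close> the gap to the
  claimed minimum is \<open>\<Sum>i. y\<^sub>i - 1 - ln y\<^sub>i\<close>, whose terms are nonnegative and vanish only
  at \<open>y\<^sub>i = 1\<close>.\<close>

lemma trace_ln_det_bound:
  fixes A X :: "real^'n^'n"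
  assumes A: "pos_def A" and X: "pos_def X"
  shows "real CARD('n) + ln (det A) \<le> trace (A ** X) - ln (det X)"
    and "trace (A ** X) - ln (det X) = real CARD('n) + ln (det A) \<Longrightarrow> X = matrix_inv A"
proof -
  define B where "B = matrix_sqrt A"
  have B: "pos_semidef B" "B ** B = A" and sB: "symmetric_matrix B"
    using pos_semidef_matrix_sqrt[of A] A
    by (auto simp: B_def pos_def_iff_pos_semidef_det pos_semidef_def)
  define Y where "Y = B ** X ** B"
  have "pos_semidef Y"
    using X sB by (simp add: Y_def pos_semidef_congruence pos_def_iff_pos_semidef_det)
  moreover have detY: "det Y = det A * det X"
    by (simp add: Y_def det_mul flip: B(2))
  ultimately have Ypd: "pos_def Y"
    using A X by (simp add: pos_def_iff_pos_semidef_det)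
  then have "symmetric_matrix Y" by (simp add: pos_def_def)
  then obtain P y where P: "orthogonal_matrix P" and Y: "Y = spectral_matrix P y"
    by (rule symmetric_matrix_spectral)
  have y: "0 < y i" for i using Ypd by (simp add: Y pos_def_spectral_matrix[OF P])
  have "trace (A ** X) = trace Y"
    unfolding Y_def B(2)[symmetric] by (metis matrix_mul_assoc trace_mul_sym)
  then have tr: "trace (A ** X) = (\<Sum>i\<in>UNIV. y i)"
    by (simp add: Y trace_spectral_matrix[OF P])
  have "det A * det X = (\<Prod>i\<in>UNIV. y i)"
    by (simp add: detY[symmetric] Y det_spectral_matrix[OF P])
  moreover have "0 < det A" "0 < det X" using A X by (auto simp: pos_def_iff_pos_semidef_det)
  ultimately have "ln (det A) + ln (det X) = (\<Sum>i\<in>UNIV. ln (y i))"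
    using y by (metis finite ln_mult_pos ln_prod less_irrefl)
  then have gap: "trace (A ** X) - ln (det X) - (real CARD('n) + ln (det A))
      = (\<Sum>i\<in>UNIV. y i - 1 - ln (y i))"
    by (simp add: tr sum_subtractf sum.distrib algebra_simps)
  have nonneg: "0 \<le> y i - 1 - ln (y i)" for i
    using ln_le_minus_one[OF y[of i]] by simp
  have "0 \<le> (\<Sum>i\<in>UNIV. y i - 1 - ln (y i))" by (intro sum_nonneg nonneg)
  then show "real CARD('n) + ln (det A) \<le> trace (A ** X) - ln (det X)" using gap by simp
  show "X = matrix_inv A" if "trace (A ** X) - ln (det X) = real CARD('n) + ln (det A)"
  proof -
    have "(\<Sum>i\<in>UNIV. y i - 1 - ln (y i)) = 0" using gap that by simp
    then have "y i - 1 - ln (y i) = 0" for i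
      using nonneg by (simp add: sum_nonneg_eq_0_iff)
    then have "y i = 1" for i using y by (simp add: ln_eq_minus_one)
    then have "y = (\<lambda>_. 1)" by auto
    then have "(B ** X) ** B = mat 1" by (simp add: Y_def[symmetric] Y spectral_matrix_one[OF P])
    then have "B ** (B ** X) = mat 1" using matrix_left_right_inverse by blast
    then have "A ** X = mat 1" by (simp add: matrix_mul_assoc B(2))
    then show ?thesis by (rule matrix_inv_eqI[symmetric])
  qed
qed

lemma mem_kl_ball:
  fixes S Sh :: "real^'n^'n"
  shows "S \<in> kl_ball Sh \<epsilon> \<longleftrightarrow> pos_def S \<and>
    - ln (det S) + ln (det Sh) + trace (S ** matrix_inv Sh) - real CARD('n) \<le> 2 * \<epsilon>"
  by (auto simp: kl_ball_def kl_div_def pos_def_iff_pos_semidef_det)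

text \<open>Sufficiency of the optimality conditions. The Lagrangian \<open>\<langle>L, S\<rangle> + \<gamma> KL(S)\<close> is, up to a
  positive factor and a constant, the barrier \<open>tr (A S) - ln det S\<close> of
  \<open>A = Sh\<^sup>-\<^sup>1 + (2/\<gamma>) L\<close>, so \<open>A\<^sup>-\<^sup>1\<close> is its only minimiser. Since the constraint is tight
  at that point, \<open>KL(S)\<close> is no larger on the ball than at the minimiser, and a point of
  the ball with at most the same objective has at most the same Lagrangian.\<close>

lemma lin_min_eq_sigma_star:
  fixes Sh L :: "real^'n^'n"
  assumes L: "symmetric_matrix L" and \<gamma>: "0 < \<gamma>"
    and A: "pos_def (matrix_inv Sh + (2 / \<gamma>) *\<^sub>R L)"
    and kl: "kl_div (sigma_star Sh L \<gamma>) Sh = ereal \<epsilon>"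
  shows "lin_min Sh \<epsilon> L = {sigma_star Sh L \<gamma>}"
proof -
  define A where "A = matrix_inv Sh + (2 / \<gamma>) *\<^sub>R L"
  define J where "J S = trace (A ** S) - ln (det S)" for S
  define K where "K S = - ln (det S) + ln (det Sh) + trace (S ** matrix_inv Sh) - real CARD('n)"
    for S
  let ?X = "sigma_star Sh L \<gamma>"
  have Apd: "pos_def A" using A by (simp add: A_def)
  have X: "A ** ?X = mat 1" "pos_def ?X"
    using pos_def_inverse[OF Apd] by (auto simp: sigma_star_def A_def)
  have "det A * det ?X = 1" by (metis X(1) det_I det_mul)
  moreover have "0 < det A" "0 < det ?X" using Apd X(2) by (auto simp: pos_def_iff_pos_semidef_det)
  ultimately have "ln (det A) + ln (det ?X) = 0"
    by (metis less_irrefl ln_mult_pos ln_one)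
  then have JX: "J ?X = real CARD('n) + ln (det A)"
    by (simp add: J_def X(1) trace_I)
  have KX: "K ?X = 2 * \<epsilon>"
    using kl X(2) by (simp add: kl_div_def K_def pos_def_iff_pos_semidef_det)
  have J: "J S = (2 / \<gamma>) * frob_inner L S + K S - ln (det Sh) + real CARD('n)" for S
  proof -
    have "trace (c *\<^sub>R L ** S) = c * trace (L ** S)" for c
      by (simp add: trace_def matrix_matrix_mult_def sum_distrib_left mult.assoc)
    then show ?thesis
      using L by (simp add: J_def K_def A_def matrix_add_rdistrib trace_add frob_inner_def
          symmetric_matrix_def trace_mul_sym[of S])
  qed
  have XB: "?X \<in> kl_ball Sh \<epsilon>" using X(2) KX by (simp add: mem_kl_ball K_def)
  have le: "(2 / \<gamma>) * frob_inner L ?X \<le> (2 / \<gamma>) * frob_inner L S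
      \<and> (frob_inner L S \<le> frob_inner L ?X \<longrightarrow> S = ?X)" if "S \<in> kl_ball Sh \<epsilon>" for S
  proof -
    have S: "pos_def S" and KS: "K S \<le> 2 * \<epsilon>" using that by (auto simp: mem_kl_ball K_def)
    have JS: "J ?X \<le> J S" using trace_ln_det_bound(1)[OF Apd S] by (simp add: JX, simp add: J_def)
    moreover have "S = ?X" if "frob_inner L S \<le> frob_inner L ?X"
    proof -
      have "(2 / \<gamma>) * frob_inner L S \<le> (2 / \<gamma>) * frob_inner L ?X"
        using that \<gamma> by (intro mult_left_mono) auto
      then have "J S \<le> J ?X" using KS KX by (simp add: J)
      then have "S = matrix_inv A"
        using trace_ln_det_bound(2)[OF Apd S] JS JX by (simp add: J_def)
      then show ?thesis by (simp add: sigma_star_def A_def)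
    qed
    ultimately show ?thesis using KS KX by (auto simp: J)
  qed
  then have "frob_inner L ?X \<le> frob_inner L S" if "S \<in> kl_ball Sh \<epsilon>" for S
    using that \<gamma> by (metis divide_pos_pos mult_le_cancel_left_pos zero_less_numeral)
  then show ?thesis
    using XB le by (auto simp: lin_min_def is_arg_min_linorder)
qed

section \<open>Reduction to eigenvalues\<close>

text \<open>The divergence is invariant under congruence: \<open>R Y R\<close> relative to \<open>R R\<close> is as far as \<open>Y\<close>
  relative to the identity, so only the eigenvalues of \<open>Y\<close> matter. Each contributes its
  Burg entropy \<open>y - 1 - ln y\<close>.\<close>

lemma kl_div_congruence:
  fixes Sh :: "real^'n^'n"
  assumes Sh: "pos_def Sh" and P: "orthogonal_matrix P" and y: "\<And>i. 0 < y i"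
  shows "kl_div (matrix_sqrt Sh ** spectral_matrix P y ** matrix_sqrt Sh) Sh
    = ereal (1 / 2 * (\<Sum>i\<in>UNIV. y i - 1 - ln (y i)))"
proof -
  let ?R = "matrix_sqrt Sh" and ?Y = "spectral_matrix P y"
  obtain Q where Q: "?R ** Q = mat 1" "Q ** ?R = mat 1" "matrix_inv Sh = Q ** Q"
    using pos_def_matrix_sqrt_inverse[OF Sh] by blast
  have "?R ** ?R = Sh"
    using pos_semidef_matrix_sqrt(2) Sh by (auto simp: pos_def_iff_pos_semidef_det)
  then have "det Sh = det ?R * det ?R" by (metis det_mul)
  then have det: "det (?R ** ?Y ** ?R) = det Sh * (\<Prod>i\<in>UNIV. y i)"
    by (simp add: det_mul det_spectral_matrix[OF P])
  have pos: "0 < det Sh" "0 < (\<Prod>i\<in>UNIV. y i)"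
    using Sh y by (auto simp: pos_def_iff_pos_semidef_det prod_pos)
  have "?R ** ?Y ** ?R ** (Q ** Q) = ?R ** ?Y ** (?R ** Q) ** Q"
    by (simp only: matrix_mul_assoc)
  also have "\<dots> = ?R ** (?Y ** Q)" by (simp add: Q matrix_mul_assoc)
  finally have "trace (?R ** ?Y ** ?R ** matrix_inv Sh) = trace (?R ** (?Y ** Q))"
    by (simp only: Q(3))
  also have "\<dots> = trace (?Y ** Q ** ?R)" by (rule trace_mul_sym)
  also have "\<dots> = (\<Sum>i\<in>UNIV. y i)"
    by (simp add: matrix_mul_assoc[symmetric] Q trace_spectral_matrix[OF P])
  finally have tr: "trace (?R ** ?Y ** ?R ** matrix_inv Sh) = (\<Sum>i\<in>UNIV. y i)" .
  have "ln (\<Prod>i\<in>UNIV. y i) = (\<Sum>i\<in>UNIV. ln (y i))"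
    using y by (metis finite ln_prod less_irrefl)
  then have "ln (det (?R ** ?Y ** ?R)) = ln (det Sh) + (\<Sum>i\<in>UNIV. ln (y i))"
    using pos by (simp add: det ln_mult_pos)
  then show ?thesis
    unfolding kl_div_def tr using pos by (simp add: det sum_subtractf sum.distrib algebra_simps)
qed

text \<open>With \<open>R\<close> the square root of \<open>Sh\<close> and \<open>M = R L R\<close>, one has
  \<open>Sh\<^sup>-\<^sup>1 + c L = R\<^sup>-\<^sup>1 (1 + c M) R\<^sup>-\<^sup>1\<close>, and the middle factor is diagonalised together
  with \<open>M\<close>.\<close>

lemma sigma_star_spectral:
  fixes Sh L :: "real^'n^'n"
  assumes Sh: "pos_def Sh" and L: "symmetric_matrix L" and P: "orthogonal_matrix P"
    and M: "matrix_sqrt Sh ** L ** matrix_sqrt Sh = spectral_matrix P m"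
    and pos: "\<And>i. 0 < 1 + (2 / \<gamma>) * m i"
  shows "pos_def (matrix_inv Sh + (2 / \<gamma>) *\<^sub>R L)"
    and "sigma_star Sh L \<gamma>
      = matrix_sqrt Sh ** spectral_matrix P (\<lambda>i. 1 / (1 + (2 / \<gamma>) * m i)) ** matrix_sqrt Sh"
proof -
  let ?R = "matrix_sqrt Sh" and ?c = "2 / \<gamma>"
  obtain Q where Q: "symmetric_matrix Q" "?R ** Q = mat 1" "Q ** ?R = mat 1"
      "matrix_inv Sh = Q ** Q" "det Q \<noteq> 0"
    using pos_def_matrix_sqrt_inverse[OF Sh] by blast
  let ?N = "spectral_matrix P (\<lambda>i. 1 + ?c * m i)"
  let ?Y = "spectral_matrix P (\<lambda>i. 1 / (1 + ?c * m i))"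
  have N: "?N = mat 1 + ?c *\<^sub>R spectral_matrix P m"
    by (simp add: spectral_matrix_scaleR spectral_matrix_add flip: spectral_matrix_one[OF P])
  have "Q ** spectral_matrix P m ** Q = (Q ** ?R) ** L ** (?R ** Q)"
    by (simp only: M[symmetric] matrix_mul_assoc)
  then have LQ: "L = Q ** spectral_matrix P m ** Q" by (simp add: Q)
  then have eq: "matrix_inv Sh + ?c *\<^sub>R L = Q ** ?N ** Q"
    by (simp only: N LQ Q(4) matrix_mul_rid matrix_add_ldistrib matrix_add_rdistrib
        matrix_scalar_ac scalar_matrix_assoc)
  have NY: "?N ** ?Y = mat 1"
    using pos[THEN less_imp_neq]
    by (simp add: spectral_matrix_mult[OF P] spectral_matrix_one[OF P])
  have Npd: "pos_def ?N" using pos by (simp add: pos_def_spectral_matrix[OF P])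
  then show "pos_def (matrix_inv Sh + ?c *\<^sub>R L)"
    unfolding eq by (rule pos_def_congruence[OF _ Q(1,5)])
  have "(Q ** ?N ** Q) ** (?R ** ?Y ** ?R) = Q ** ?N ** (Q ** ?R) ** ?Y ** ?R"
    by (simp only: matrix_mul_assoc)
  also have "\<dots> = Q ** (?N ** ?Y) ** ?R" by (simp add: Q matrix_mul_assoc)
  also have "\<dots> = mat 1" by (simp only: NY matrix_mul_rid Q)
  finally show "sigma_star Sh L \<gamma> = ?R ** ?Y ** ?R"
    unfolding sigma_star_def eq by (rule matrix_inv_eqI)
qed

text \<open>The lower bound on the multiplier is exactly the condition under which the closed form
  is positive definite.\<close>

lemma lambda_max_less_iff:
  assumes P: "orthogonal_matrix P" and \<gamma>: "0 < \<gamma>"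
  shows "2 * lambda_max (- spectral_matrix P m) < \<gamma> \<longleftrightarrow> (\<forall>i. 0 < 1 + (2 / \<gamma>) * m i)"
proof -
  have "lambda_max (- spectral_matrix P m) = Max (range (\<lambda>i. - m i))"
    by (simp add: lambda_max_def spectral_matrix_uminus eigenvalues_spectral_matrix[OF P])
  then have "2 * lambda_max (- spectral_matrix P m) < \<gamma> \<longleftrightarrow> Max (range (\<lambda>i. - m i)) < \<gamma> / 2"
    by auto
  also have "\<dots> \<longleftrightarrow> (\<forall>i. - m i < \<gamma> / 2)" by (subst Max_less_iff) auto
  also have "\<dots> \<longleftrightarrow> (\<forall>i. 0 < 1 + (2 / \<gamma>) * m i)"
    using \<gamma> by (intro all_cong1) (auto simp: field_simps)
  finally show ?thesis .
qed

section \<open>Existence and size of the multiplier\<close>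

text \<open>By \<open>ln (1 + u) \<le> u\<close> the left-hand side is at most \<open>u\<^sup>2 / (1 + u)\<close>. One factor \<open>\<bar>u\<bar>\<close> is
  kept, so that summation over the eigenvalues yields the nuclear norm.\<close>

lemma burg_inverse_bound:
  fixes u s :: real
  assumes "\<bar>u\<bar> \<le> s" "s < 1"
  shows "1 / (1 + u) - 1 - ln (1 / (1 + u)) \<le> s * \<bar>u\<bar> / (1 - s)"
proof -
  have pos: "0 < 1 + u" "0 < 1 - s" using assms by auto
  have "ln (1 + u) \<le> u" using ln_le_minus_one[OF pos(1)] by simp
  then have "1 / (1 + u) - 1 - ln (1 / (1 + u)) \<le> 1 / (1 + u) - 1 + u"
    using pos by (simp add: ln_div)
  also have "\<dots> = u\<^sup>2 / (1 + u)" using pos by (simp add: field_simps power2_eq_square)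
  also have "\<dots> \<le> s * \<bar>u\<bar> / (1 - s)"
  proof (rule frac_le)
    show "u\<^sup>2 \<le> s * \<bar>u\<bar>"
      using assms(1) by (metis abs_ge_zero mult_right_mono power2_abs power2_eq_square)
  qed (use assms pos in auto)
  finally show ?thesis .
qed

text \<open>As \<open>m\<close> will list the eigenvalues of a matrix, \<open>\<Sum>i. \<bar>m\<^sub>i\<bar>\<close> is its nuclear norm. It also
  bounds each single \<open>\<bar>m\<^sub>i\<bar>\<close>, so every denominator is at least \<open>1 - s\<close>.\<close>

lemma burg_inverse_sum_bound:
  fixes m :: "'n::finite \<Rightarrow> real"
  assumes t: "0 \<le> t" and s: "t * (\<Sum>i\<in>UNIV. \<bar>m i\<bar>) \<le> s" "s < 1"
  shows "(\<Sum>i\<in>UNIV. 1 / (1 + t * m i) - 1 - ln (1 / (1 + t * m i))) \<le> s\<^sup>2 / (1 - s)"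
proof -
  have "\<bar>t * m i\<bar> \<le> t * (\<Sum>i\<in>UNIV. \<bar>m i\<bar>)" for i
  proof -
    have "\<bar>m i\<bar> \<le> (\<Sum>i\<in>UNIV. \<bar>m i\<bar>)" by (rule member_le_sum) auto
    then show ?thesis using t by (simp add: abs_mult mult_left_mono)
  qed
  then have tm: "\<bar>t * m i\<bar> \<le> s" for i using s by (meson order_trans)
  have "(\<Sum>i\<in>UNIV. 1 / (1 + t * m i) - 1 - ln (1 / (1 + t * m i)))
      \<le> (\<Sum>i\<in>UNIV. s * \<bar>t * m i\<bar> / (1 - s))"
    by (intro sum_mono burg_inverse_bound tm s)
  also have "\<dots> = s * (t * (\<Sum>i\<in>UNIV. \<bar>m i\<bar>)) / (1 - s)"
    using t by (simp add: abs_mult sum_distrib_left sum_divide_distrib)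
  also have "\<dots> \<le> s * s / (1 - s)"
    using s t by (intro divide_right_mono mult_left_mono) (auto intro: order_trans[OF _ s(1)] simp: sum_nonneg)
  finally show "(\<Sum>i\<in>UNIV. 1 / (1 + t * m i) - 1 - ln (1 / (1 + t * m i))) \<le> s\<^sup>2 / (1 - s)"
    by (simp add: power2_eq_square)
qed

text \<open>This is \<open>v / \<epsilon>\<close>, where \<open>v\<close> is \<open>sqrt (6 \<epsilon>)\<close> up to \<open>\<epsilon> = 1/24\<close> and \<open>6 \<epsilon> + 1/4\<close> from there
  on; both expressions are \<open>1/2\<close> at the threshold.\<close>

definition multiplier_factor :: "real \<Rightarrow> real" where
  "multiplier_factor \<epsilon> = sqrt (6 / \<epsilon>) * indicator {0..1/24} \<epsilon>
     + (6 + 1 / (4 * \<epsilon>)) * indicator {1/24<..} \<epsilon>"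

lemma multiplier_factor_pos: "0 < \<epsilon> \<Longrightarrow> 0 < multiplier_factor \<epsilon>"
  by (simp add: multiplier_factor_def indicator_def add_pos_pos)

text \<open>A multiplier equal to the factor times the nuclear norm \<open>N\<close> corresponds to \<open>t N = s\<close>,
  where \<open>t\<close> is twice the inverse multiplier. For such \<open>t\<close> twice the divergence is at most
  \<open>s\<^sup>2 / (1 - s)\<close>, so it has not passed the radius.\<close>

lemma multiplier_factor_suffices:
  assumes \<epsilon>: "0 < \<epsilon>"
  defines "s \<equiv> 2 / multiplier_factor \<epsilon>"
  shows "0 < s" "s < 1" "s\<^sup>2 / (1 - s) \<le> 2 * \<epsilon>"
proof -
  show s0: "0 < s" using multiplier_factor_pos[OF \<epsilon>] by (simp add: s_def)
  have "s < 1 \<and> s\<^sup>2 / (1 - s) \<le> 2 * \<epsilon>"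
  proof (cases "\<epsilon> \<le> 1 / 24")
    case True
    have "s = 2 / sqrt (6 / \<epsilon>)" using True \<epsilon> by (simp add: s_def multiplier_factor_def)
    then have s2: "s\<^sup>2 = 2 / 3 * \<epsilon>" using \<epsilon> by (simp add: power_divide)
    then have "s\<^sup>2 \<le> (1 / 6)\<^sup>2" using True by (simp add: power2_eq_square)
    then have s6: "s \<le> 1 / 6" by (rule power2_le_imp_le) simp
    then have "2 / 3 * \<epsilon> \<le> 2 * \<epsilon> * (1 - s)" using \<epsilon> mult_left_mono[of "5/6" "1 - s" "2 * \<epsilon>"] by simp
    then have "s\<^sup>2 \<le> 2 * \<epsilon> * (1 - s)" by (simp only: s2)
    moreover have "0 < 1 - s" using s6 by simp
    ultimately show ?thesis by (simp only: pos_divide_le_eq) simp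
  next
    case False
    have s: "s = 8 * \<epsilon> / (24 * \<epsilon> + 1)"
      using False \<epsilon> by (simp add: s_def multiplier_factor_def field_simps)
    have "1 - s = ((24 * \<epsilon> + 1) - 8 * \<epsilon>) / (24 * \<epsilon> + 1)"
      using \<epsilon> by (simp only: s diff_divide_distrib) simp
    then have s1: "1 - s = (16 * \<epsilon> + 1) / (24 * \<epsilon> + 1)" by simp
    have "s\<^sup>2 / (1 - s) = 64 * \<epsilon>\<^sup>2 / ((24 * \<epsilon> + 1) * (16 * \<epsilon> + 1))"
      unfolding s1 unfolding s using \<epsilon> by (simp add: power2_eq_square)
    also have "\<dots> \<le> 2 * \<epsilon>"
    proof -
      have "2 * \<epsilon> * ((24 * \<epsilon> + 1) * (16 * \<epsilon> + 1)) - 64 * \<epsilon>\<^sup>2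
          = 768 * \<epsilon> ^ 3 + 16 * \<epsilon>\<^sup>2 + 2 * \<epsilon>"
        by (simp add: algebra_simps power2_eq_square power3_eq_cube)
      moreover have "0 \<le> 768 * \<epsilon> ^ 3 + 16 * \<epsilon>\<^sup>2 + 2 * \<epsilon>" using \<epsilon> by simp
      moreover have "0 < (24 * \<epsilon> + 1) * (16 * \<epsilon> + 1)" using \<epsilon> by simp
      ultimately show ?thesis by (simp only: pos_divide_le_eq)
    qed
    moreover have "0 < 1 - s" using \<epsilon> by (simp add: s1)
    ultimately show ?thesis by simp
  qed
  then show "s < 1" "s\<^sup>2 / (1 - s) \<le> 2 * \<epsilon>" by auto
qed

text \<open>The intermediate value theorem for the divergence of the closed form as a function \<open>K\<close>
  of \<open>t = 2/\<gamma>\<close>; here \<open>m\<close> lists the eigenvalues of \<open>R L R\<close>. The lower endpoint \<open>t\<^sub>0\<close> is the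
  image of the claimed upper bound on \<open>\<gamma>\<close>, and \<open>K\<close> is at most \<open>2 \<epsilon>\<close> up to there. The upper
  endpoint \<open>t\<^sub>1\<close> is chosen so that one eigenvalue \<open>y = 1 / (1 + t\<^sub>1 m\<^sub>k)\<close> alone
  contributes more than \<open>2 \<epsilon>\<close>: a very large \<open>y\<close> if some \<open>m\<^sub>k\<close> is negative, a very small
  one otherwise.\<close>

lemma burg_multiplier_exists:
  fixes m :: "'n::finite \<Rightarrow> real"
  assumes \<epsilon>: "0 < \<epsilon>" and m: "m j \<noteq> 0"
  obtains t where "0 < t" "2 / t \<le> (\<Sum>i\<in>UNIV. \<bar>m i\<bar>) * multiplier_factor \<epsilon>"
    "\<And>i. 0 < 1 + t * m i"
    "(\<Sum>i\<in>UNIV. 1 / (1 + t * m i) - 1 - ln (1 / (1 + t * m i))) = 2 * \<epsilon>"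
proof -
  define N where "N = (\<Sum>i\<in>UNIV. \<bar>m i\<bar>)"
  define K where "K t = (\<Sum>i\<in>UNIV. 1 / (1 + t * m i) - 1 - ln (1 / (1 + t * m i)))" for t
  define s where "s = 2 / multiplier_factor \<epsilon>"
  have s: "0 < s" "s < 1" "s\<^sup>2 / (1 - s) \<le> 2 * \<epsilon>"
    using multiplier_factor_suffices[OF \<epsilon>] by (simp_all add: s_def)
  have "\<bar>m j\<bar> \<le> N" unfolding N_def by (rule member_le_sum) auto
  then have N: "0 < N" using m by simp
  define t0 where "t0 = s / N"
  have t0: "0 < t0" using s N by (simp add: t0_def)
  have low: "K t \<le> 2 * \<epsilon>" if "0 \<le> t" "t \<le> t0" for t
  proof -
    have "t * N \<le> s" using that N by (simp add: t0_def pos_le_divide_eq)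
    then show ?thesis
      using burg_inverse_sum_bound[of t m s] that s by (simp add: K_def N_def)
  qed
  obtain t1 where t1: "0 < t1" "\<And>i. 0 < 1 + t1 * m i" "2 * \<epsilon> < K t1"
  proof -
    have Kge: "2 * \<epsilon> < K t" if "\<And>i. 0 < 1 + t * m i" "1 + t * m k = 1 / y" "2 * \<epsilon> < y - 1 - ln y"
      for t k y
    proof -
      have "1 / (1 + t * m k) - 1 - ln (1 / (1 + t * m k)) \<le> K t"
        unfolding K_def
      proof (rule member_le_sum)
        show "0 \<le> 1 / (1 + t * m i) - 1 - ln (1 / (1 + t * m i))" for i
          using ln_le_minus_one[of "1 / (1 + t * m i)"] that(1)[of i] by simp
      qed auto
      then show ?thesis using that(2,3) by simp
    qed
    show thesis
    proof (cases "\<exists>i. m i < 0")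
      case True
      have "Min (range m) \<in> range m" by (rule Min_in) auto
      then obtain k where k: "Min (range m) = m k" by blast
      have min: "m k \<le> m i" for i unfolding k[symmetric] by (rule Min_le) auto
      then have neg: "m k < 0" using True by (meson le_less_trans)
      \<comment> \<open>large enough since \<open>ln y \<le> y / 2\<close>; as \<open>m k\<close> is minimal, \<open>1 + t * m i\<close> is at least \<open>1 / y\<close> for every \<open>i\<close>\<close>
      define y where "y = 4 * \<epsilon> + 3"
      define t where "t = (1 - 1 / y) / (- m k)"
      have y: "1 < y" using \<epsilon> by (simp add: y_def)
      then have t: "0 < t" using neg by (simp add: t_def divide_pos_neg)
      have tk: "1 + t * m k = 1 / y" using neg by (simp add: t_def)
      have "0 < 1 + t * m i" for i
        using mult_left_mono[OF min, of t i] t tk y by (smt (verit) zero_less_divide_1_iff)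
      moreover have "2 * \<epsilon> < y - 1 - ln y"
      proof -
        have "ln (y / 2) \<le> y / 2 - 1" "ln 2 \<le> (2 :: real) - 1"
          using y by (intro ln_le_minus_one; simp)+
        moreover have "ln (y / 2) = ln y - ln 2" using y by (simp add: ln_div)
        ultimately show ?thesis using y_def by linarith
      qed
      ultimately show thesis using that[OF t] Kge[OF _ tk] by blast
    next
      case False
      then have nonneg: "0 \<le> m i" for i by (meson not_le)
      then have pos: "0 < m j" using m by (metis less_eq_real_def)
      \<comment> \<open>small enough since already \<open>- 1 - ln y = 1 + 2 * \<epsilon>\<close>\<close>
      define y where "y = exp (- 2 - 2 * \<epsilon>)"
      define t where "t = (1 / y - 1) / m j"
      have "y < 1" using \<epsilon> by (simp add: y_def)
      moreover have y: "0 < y" by (simp add: y_def)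
      ultimately have t: "0 < t" using pos by (simp add: t_def)
      have tk: "1 + t * m j = 1 / y" using pos by (simp add: t_def)
      have "0 < 1 + t * m i" for i
        using nonneg[of i] t by (simp add: add_pos_nonneg)
      moreover have "2 * \<epsilon> < y - 1 - ln y" by (simp add: y_def add_pos_pos)
      ultimately show thesis using that[OF t] Kge[OF _ tk] by blast
    qed
  qed
  have "t0 \<le> t1" using low[of t1] t1 by (cases "t1 \<le> t0") auto
  have pos: "0 < 1 + t * m i" if "t \<in> {t0..t1}" for t i
  proof (cases "0 \<le> m i")
    case True
    then show ?thesis using that t0 by (simp add: add_pos_nonneg)
  next
    case False
    then have "t1 * m i \<le> t * m i" using that by (intro mult_right_mono_neg) auto
    then show ?thesis using t1(2)[of i] by linarith
  qed
  have "continuous_on {t0..t1} K"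
    unfolding K_def using pos
    by (intro continuous_intros) (auto simp: less_imp_neq[symmetric])
  then obtain t where t: "t0 \<le> t" "t \<le> t1" "K t = 2 * \<epsilon>"
    using IVT'[of K t0 "2 * \<epsilon>" t1] low[of t0] t0 t1 \<open>t0 \<le> t1\<close> by auto
  have "2 / t \<le> 2 / t0" using t t0 by (intro divide_left_mono) auto
  also have "\<dots> = N * multiplier_factor \<epsilon>" by (simp add: t0_def s_def)
  finally show thesis
    using that[of t] t t0 pos by (simp add: K_def N_def)
qed

text \<open>A multiplier in the stated range exists by the scalar analysis of the eigenvalues of
  \<open>M\<close>. Conversely, for every multiplier in the range the closed form is positive definite
  and meets the constraint with equality, so that the Lagrangian argument applies.\<close>

lemma kl_oracle_closed_form:
  fixes Sh L :: "real^'n^'n"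
  assumes Sh: "pos_def Sh" and L: "symmetric_matrix L" "L \<noteq> 0" and \<epsilon>: "0 < \<epsilon>"
  defines "M \<equiv> matrix_sqrt Sh ** L ** matrix_sqrt Sh"
  defines "G \<equiv> {\<gamma>. kl_div (sigma_star Sh L \<gamma>) Sh - ereal \<epsilon> = 0
      \<and> max 0 (2 * lambda_max (- M)) < \<gamma> \<and> \<gamma> \<le> nuclear_norm M * multiplier_factor \<epsilon>}"
  shows "G \<noteq> {}" and "\<gamma> \<in> G \<Longrightarrow> lin_min Sh \<epsilon> L = {sigma_star Sh L \<gamma>}"
proof -
  have "symmetric_matrix (matrix_sqrt Sh)"
    using Sh pos_semidef_matrix_sqrt(1) by (auto simp: pos_def_iff_pos_semidef_det pos_semidef_def)
  with L(1) have "symmetric_matrix M"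
    unfolding M_def by (rule symmetric_matrix_congruence)
  then obtain P m where P: "orthogonal_matrix P" and M: "M = spectral_matrix P m"
    by (rule symmetric_matrix_spectral)
  note star = sigma_star_spectral[OF Sh L(1) P M[unfolded M_def]]
  \<comment> \<open>\<open>M\<close> is nonzero along with \<open>L\<close>, as the square root is invertible\<close>
  obtain j where j: "m j \<noteq> 0"
  proof -
    obtain Q where Q: "matrix_sqrt Sh ** Q = mat 1" "Q ** matrix_sqrt Sh = mat 1"
      using pos_def_matrix_sqrt_inverse[OF Sh] by blast
    have "Q ** M ** Q = (Q ** matrix_sqrt Sh) ** L ** (matrix_sqrt Sh ** Q)"
      by (simp only: M_def matrix_mul_assoc)
    then have "L = Q ** M ** Q" by (simp add: Q)
    then have "M \<noteq> 0" using L(2) by auto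
    moreover have "spectral_matrix P (\<lambda>i. 0 * 1) = 0"
      by (simp only: spectral_matrix_scaleR[symmetric] scaleR_zero_left)
    ultimately have "m \<noteq> (\<lambda>i. 0)" by (auto simp: M)
    then show thesis using that by blast
  qed
  show "G \<noteq> {}"
  proof -
    obtain t where t: "0 < t" "2 / t \<le> (\<Sum>i\<in>UNIV. \<bar>m i\<bar>) * multiplier_factor \<epsilon>"
      "\<And>i. 0 < 1 + t * m i"
      "(\<Sum>i\<in>UNIV. 1 / (1 + t * m i) - 1 - ln (1 / (1 + t * m i))) = 2 * \<epsilon>"
      using burg_multiplier_exists[where m = m and j = j, OF \<epsilon> j] by blast
    define \<gamma> where "\<gamma> = 2 / t"
    have \<gamma>: "0 < \<gamma>" and t_eq: "t = 2 / \<gamma>" using t(1) by (auto simp: \<gamma>_def)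
    have "kl_div (sigma_star Sh L \<gamma>) Sh = ereal \<epsilon>"
      using t(3,4) unfolding t_eq by (simp add: star kl_div_congruence[OF Sh P])
    moreover have "2 * lambda_max (- M) < \<gamma>"
      using t(3) by (simp add: M lambda_max_less_iff[OF P \<gamma>] t_eq)
    moreover have "\<gamma> \<le> nuclear_norm M * multiplier_factor \<epsilon>"
      using t(2) by (simp add: M nuclear_norm_spectral_matrix[OF P] \<gamma>_def)
    ultimately have "\<gamma> \<in> G" using \<gamma> by (simp add: G_def)
    then show ?thesis by blast
  qed
  show "lin_min Sh \<epsilon> L = {sigma_star Sh L \<gamma>}" if "\<gamma> \<in> G"
  proof (rule lin_min_eq_sigma_star[OF L(1)])
    show \<gamma>: "0 < \<gamma>" using that by (simp add: G_def)
    have "\<forall>i. 0 < 1 + (2 / \<gamma>) * m i"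
      using that by (simp only: lambda_max_less_iff[OF P \<gamma>, symmetric]) (simp add: G_def M)
    then show "pos_def (matrix_inv Sh + (2 / \<gamma>) *\<^sub>R L)" using star(1) by blast
    have "kl_div (sigma_star Sh L \<gamma>) Sh - ereal \<epsilon> = 0" using that by (simp add: G_def)
    then show "kl_div (sigma_star Sh L \<gamma>) Sh = ereal \<epsilon>"
      by (cases "kl_div (sigma_star Sh L \<gamma>) Sh") (auto simp: zero_ereal_def)
  qed
qed

section \<open>The size of the ball\<close>

text \<open>Equality holds at \<open>0\<close>, and the difference of the two sides has derivative
  \<open>v (1 - 2 v) / (3 (1 + v))\<close>, which is nonnegative exactly on this interval.\<close>

lemma ln_one_plus_gap_small:
  fixes v :: real
  assumes "0 \<le> v" "v \<le> 1 / 2"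
  shows "v\<^sup>2 / 3 \<le> v - ln (1 + v)"
proof -
  define f where "f x = x - ln (1 + x) - x\<^sup>2 / 3" for x :: real
  have "f 0 \<le> f v"
  proof (rule DERIV_nonneg_imp_nondecreasing[OF assms(1)])
    fix x :: real assume x: "0 \<le> x" "x \<le> v"
    have "(f has_real_derivative (1 - 1 / (1 + x) - 2 * x / 3)) (at x)"
      unfolding f_def using x by (auto intro!: derivative_eq_intros)
    moreover have "0 \<le> 1 - 1 / (1 + x) - 2 * x / 3"
    proof -
      have "0 \<le> x * (1 - 2 * x) / (3 * (1 + x))" using x assms by auto
      also have "\<dots> = 1 - 1 / (1 + x) - 2 * x / 3" using x by (simp add: field_simps)
      finally show ?thesis .
    qed
    ultimately show "\<exists>y. (f has_real_derivative y) (at x) \<and> 0 \<le> y" by blast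
  qed
  then show ?thesis by (simp add: f_def)
qed

text \<open>Concavity of \<open>ln\<close>: the tangent of \<open>ln (1 + v)\<close> at \<open>v = 1/2\<close> has slope \<open>2/3\<close>, and
  \<open>ln (3/2) \<le> 5/12\<close> is the endpoint case of the quadratic bound.\<close>

lemma ln_one_plus_gap_large:
  fixes v :: real
  assumes "1 / 2 \<le> v"
  shows "v / 3 - 1 / 12 \<le> v - ln (1 + v)"
proof -
  have "ln ((1 + v) / (3 / 2)) \<le> (1 + v) / (3 / 2) - 1"
    using assms by (intro ln_le_minus_one) auto
  moreover have "ln ((1 + v) / (3 / 2)) = ln (1 + v) - ln (3 / 2)"
    using assms by (intro ln_divide_pos) auto
  moreover have "ln (3 / 2 :: real) \<le> 5 / 12"
    using ln_one_plus_gap_small[of "1 / 2"] by (simp add: power2_eq_square)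
  ultimately show ?thesis by (simp add: field_simps)
qed

text \<open>A closed-form bound for the excess \<open>y - 1\<close> of an eigenvalue \<open>y\<close> subject to
  \<open>y - 1 - ln y \<le> 2 \<epsilon>\<close>. The two branches invert a quadratic and a linear lower bound of
  \<open>v - ln (1 + v)\<close>, valid for \<open>v\<close> below and above \<open>1/2\<close>; they agree at \<open>\<epsilon> = 1/24\<close>, where
  both are \<open>1/2\<close>.\<close>

definition excess_bound :: "real \<Rightarrow> real" where
  "excess_bound \<epsilon> = sqrt (6 * \<epsilon>) * indicator {0..1/24} \<epsilon> + (6 * \<epsilon> + 1/4) * indicator {1/24<..} \<epsilon>"

lemma excess_bound_nonneg: "0 \<le> \<epsilon> \<Longrightarrow> 0 \<le> excess_bound \<epsilon>"
  by (simp add: excess_bound_def indicator_def)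

lemma le_one_plus_excess_bound:
  fixes y :: real
  assumes \<epsilon>: "0 \<le> \<epsilon>" and y: "0 < y" "y - 1 - ln y \<le> 2 * \<epsilon>"
  shows "y \<le> 1 + excess_bound \<epsilon>"
proof (cases "y \<le> 1")
  case True
  then show ?thesis using excess_bound_nonneg[OF \<epsilon>] by simp
next
  case False
  define v where "v = y - 1"
  have v: "0 < v" "v - ln (1 + v) \<le> 2 * \<epsilon>" using False y by (auto simp: v_def)
  have large: "v \<le> 6 * \<epsilon> + 1 / 4" if "1 / 2 \<le> v"
    using ln_one_plus_gap_large[OF that] v by simp
  have "v \<le> excess_bound \<epsilon>"
  proof (cases "\<epsilon> \<le> 1 / 24")
    case True
    have "v \<le> 1 / 2" using large True by (cases "1 / 2 \<le> v") auto
    then have "v\<^sup>2 \<le> 6 * \<epsilon>" using ln_one_plus_gap_small[of v] v by simp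
    then have "v \<le> sqrt (6 * \<epsilon>)" using v by (simp add: real_le_rsqrt)
    then show ?thesis using True \<epsilon> by (simp add: excess_bound_def)
  next
    case False
    then show ?thesis using large by (cases "1 / 2 \<le> v") (auto simp: excess_bound_def)
  qed
  then show ?thesis by (simp add: v_def)
qed

text \<open>Write \<open>S = R Y R\<close> with \<open>R\<close> the square root of \<open>Sh\<close>. Each eigenvalue of \<open>Y\<close> satisfies the
  scalar constraint on its own, because the other terms of the divergence are nonnegative,
  so \<open>0 \<le> Y \<le> k\<close> and \<open>- k Sh \<le> S \<le> k Sh\<close>. The inner product of the two positive
  semidefinite matrices \<open>k Sh - S\<close> and \<open>k Sh + S\<close> is nonnegative, which is
  \<open>\<parallel>S\<parallel>\<^sup>2 \<le> k\<^sup>2 \<parallel>Sh\<parallel>\<^sup>2\<close>.\<close>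

lemma kl_ball_norm_bound:
  fixes Sh :: "real^'n^'n"
  assumes Sh: "pos_def Sh" and S: "S \<in> kl_ball Sh \<epsilon>" and k: "0 \<le> k"
    and bound: "\<And>y. 0 < y \<Longrightarrow> y - 1 - ln y \<le> 2 * \<epsilon> \<Longrightarrow> y \<le> k"
  shows "norm S \<le> k * norm Sh"
proof -
  let ?R = "matrix_sqrt Sh"
  have R: "symmetric_matrix ?R" "?R ** ?R = Sh"
    using pos_semidef_matrix_sqrt Sh by (auto simp: pos_def_iff_pos_semidef_det pos_semidef_def)
  obtain Q where Q: "symmetric_matrix Q" "?R ** Q = mat 1" "Q ** ?R = mat 1" "det Q \<noteq> 0"
    using pos_def_matrix_sqrt_inverse[OF Sh] by blast
  have Spd: "pos_def S" and kl: "kl_div S Sh \<le> ereal \<epsilon>"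
    using S mem_kl_ball by (blast, simp add: kl_ball_def)
  define Y where "Y = Q ** S ** Q"
  have Ypd: "pos_def Y" unfolding Y_def by (rule pos_def_congruence[OF Spd Q(1,4)])
  then have "symmetric_matrix Y" by (simp add: pos_def_def)
  then obtain P y where P: "orthogonal_matrix P" and Y: "Y = spectral_matrix P y"
    by (rule symmetric_matrix_spectral)
  have y: "0 < y i" for i using Ypd by (simp add: Y pos_def_spectral_matrix[OF P])
  have "?R ** Y ** ?R = (?R ** Q) ** S ** (Q ** ?R)"
    by (simp only: Y_def matrix_mul_assoc)
  then have SY: "S = ?R ** spectral_matrix P y ** ?R" by (simp add: Q Y)
  have sum: "(\<Sum>i\<in>UNIV. y i - 1 - ln (y i)) \<le> 2 * \<epsilon>"
    using kl unfolding SY kl_div_congruence[OF Sh P y] by simp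
  have yk: "y i \<le> k" for i
  proof (rule bound[OF y])
    have "y i - 1 - ln (y i) \<le> (\<Sum>i\<in>UNIV. y i - 1 - ln (y i))"
      using ln_le_minus_one[OF y] by (intro member_le_sum) (auto simp: algebra_simps)
    then show "y i - 1 - ln (y i) \<le> 2 * \<epsilon>" using sum by simp
  qed
  have psd: "pos_semidef (k *\<^sub>R Sh + c *\<^sub>R S)" if "\<And>i. 0 \<le> k + c * y i" for c
  proof -
    have "spectral_matrix P (\<lambda>i. k + c * y i) = k *\<^sub>R mat 1 + c *\<^sub>R spectral_matrix P y"
      by (simp add: spectral_matrix_scaleR spectral_matrix_add flip: spectral_matrix_one[OF P])
    then have "?R ** spectral_matrix P (\<lambda>i. k + c * y i) ** ?R = k *\<^sub>R Sh + c *\<^sub>R S"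
      by (simp add: SY R(2) matrix_add_ldistrib matrix_add_rdistrib matrix_scalar_ac
          scalar_matrix_assoc[symmetric])
    moreover have "pos_semidef (spectral_matrix P (\<lambda>i. k + c * y i))"
      using that by (simp add: pos_semidef_spectral_matrix[OF P])
    ultimately show ?thesis using R(1) by (metis pos_semidef_congruence)
  qed
  have "0 \<le> (k *\<^sub>R Sh + (- 1) *\<^sub>R S) \<bullet> (k *\<^sub>R Sh + 1 *\<^sub>R S)"
    using yk k y by (intro inner_pos_semidef_nonneg psd) (auto simp: less_imp_le)
  also have "\<dots> = (k * norm Sh)\<^sup>2 - (norm S)\<^sup>2"
    by (simp add: inner_diff_left inner_add_right inner_commute power_mult_distrib
        power2_norm_eq_inner algebra_simps, simp add: power2_eq_square)
  finally have "(norm S)\<^sup>2 \<le> (k * norm Sh)\<^sup>2" by simp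
  then show ?thesis by (rule power2_le_imp_le) (use k in simp)
qed

section \<open>Attainment and the Lipschitz constant of the dual function\<close>

text \<open>In exponential form the constraint is continuous on all matrices and subsumes
  \<open>det S > 0\<close>; the ball is therefore visibly closed.\<close>

lemma kl_ball_exp_eq:
  fixes Sh :: "real^'n^'n"
  shows "kl_ball Sh \<epsilon> = {S. pos_semidef S \<and>
    exp (ln (det Sh) + trace (S ** matrix_inv Sh) - real CARD('n) - 2 * \<epsilon>) \<le> det S}"
proof -
  have "0 < det S \<and> - ln (det S) + c \<le> 2 * \<epsilon> \<longleftrightarrow> exp (c - 2 * \<epsilon>) \<le> det S"
    for S :: "real^'n^'n" and c
    using ln_ge_iff[of "det S" "c - 2 * \<epsilon>"] less_le_trans[OF exp_gt_zero, of "c - 2 * \<epsilon>" "det S"]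
    by auto
  from this[of S "ln (det Sh) + trace (S ** matrix_inv Sh) - real CARD('n)" for S]
  have "0 < det S \<and> - ln (det S) + ln (det Sh) + trace (S ** matrix_inv Sh) - real CARD('n) \<le> 2 * \<epsilon>
    \<longleftrightarrow> exp (ln (det Sh) + trace (S ** matrix_inv Sh) - real CARD('n) - 2 * \<epsilon>) \<le> det S" for S
    by (simp only: add.assoc add_diff_eq)
  then show ?thesis
    by (simp only: set_eq_iff mem_Collect_eq mem_kl_ball pos_def_iff_pos_semidef_det conj_assoc) simp
qed

lemma norm_le_of_mem_kl_ball:
  fixes Sh :: "real^'n^'n"
  assumes Sh: "pos_def Sh" and \<epsilon>: "0 \<le> \<epsilon>" and S: "S \<in> kl_ball Sh \<epsilon>"
  shows "norm S \<le> (1 + excess_bound \<epsilon>) * norm Sh"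
proof (rule kl_ball_norm_bound[OF Sh S])
  show "0 \<le> 1 + excess_bound \<epsilon>" using excess_bound_nonneg[OF \<epsilon>] by simp
qed (rule le_one_plus_excess_bound[OF \<epsilon>])

lemma compact_kl_ball:
  fixes Sh :: "real^'n^'n"
  assumes Sh: "pos_def Sh" and \<epsilon>: "0 \<le> \<epsilon>"
  shows "compact (kl_ball Sh \<epsilon>)"
proof -
  have "bounded (kl_ball Sh \<epsilon>)"
    unfolding bounded_iff using norm_le_of_mem_kl_ball[OF Sh \<epsilon>] by blast
  moreover have "closed (kl_ball Sh \<epsilon>)"
  proof -
    have "continuous_on UNIV (det :: real^'n^'n \<Rightarrow> real)"
      unfolding det_def by (intro continuous_intros)
    moreover have "continuous_on UNIV (\<lambda>S. trace (S ** matrix_inv Sh))"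
      unfolding trace_def matrix_matrix_mult_def by (simp, intro continuous_intros)
    ultimately show ?thesis
      unfolding kl_ball_exp_eq
      by (intro closed_Collect_conj closed_pos_semidef closed_Collect_le continuous_intros)
  qed
  ultimately show ?thesis by (simp add: compact_eq_bounded_closed)
qed

lemma centre_in_kl_ball:
  assumes "pos_def Sh" "0 \<le> \<epsilon>"
  shows "Sh \<in> kl_ball Sh \<epsilon>"
proof -
  have "Sh ** matrix_inv Sh = mat 1" by (rule pos_def_inverse[OF assms(1)])
  then show ?thesis using assms by (simp add: mem_kl_ball trace_I)
qed

lemma lin_min_nonempty:
  assumes "pos_def Sh" "0 \<le> \<epsilon>"
  shows "lin_min Sh \<epsilon> L \<noteq> {}"
proof -
  have "continuous_on (kl_ball Sh \<epsilon>) (frob_inner L)"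
    unfolding frob_inner_eq_inner by (intro continuous_intros)
  then obtain S where "S \<in> kl_ball Sh \<epsilon>" "\<forall>T\<in>kl_ball Sh \<epsilon>. frob_inner L S \<le> frob_inner L T"
    using continuous_attains_inf[OF compact_kl_ball[OF assms]] centre_in_kl_ball[OF assms] by blast
  then have "S \<in> lin_min Sh \<epsilon> L" by (simp add: lin_min_def is_arg_min_linorder)
  then show ?thesis by blast
qed

lemma dual_fun_eq:
  assumes "S \<in> lin_min Sh \<epsilon> L"
  shows "dual_fun Sh \<epsilon> L = frob_inner L S"
  unfolding dual_fun_def
proof (rule cInf_eq_minimum)
  show "frob_inner L S \<in> frob_inner L ` kl_ball Sh \<epsilon>"
    using assms by (simp add: lin_min_def is_arg_min_linorder)
  show "frob_inner L S \<le> x" if "x \<in> frob_inner L ` kl_ball Sh \<epsilon>" for x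
    using assms that by (auto simp: lin_min_def is_arg_min_linorder)
qed

lemma dual_fun_le:
  assumes "pos_def Sh" "0 \<le> \<epsilon>" "S \<in> kl_ball Sh \<epsilon>"
  shows "dual_fun Sh \<epsilon> L \<le> frob_inner L S"
proof -
  obtain T where T: "T \<in> lin_min Sh \<epsilon> L" using lin_min_nonempty[OF assms(1,2)] by blast
  then have "frob_inner L T \<le> frob_inner L S"
    using assms(3) by (simp add: lin_min_def is_arg_min_linorder)
  then show ?thesis by (simp add: dual_fun_eq[OF T])
qed

lemma kl_ball_norm_maximum:
  assumes "pos_def Sh" "0 \<le> \<epsilon>"
  obtains S where "S \<in> kl_ball Sh \<epsilon>" "\<And>T. T \<in> kl_ball Sh \<epsilon> \<Longrightarrow> norm T \<le> norm S"
    "lip_const Sh \<epsilon> = norm S"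
proof -
  have "continuous_on (kl_ball Sh \<epsilon>) norm" by (rule continuous_on_norm_id)
  then obtain S where S: "S \<in> kl_ball Sh \<epsilon>" "\<forall>T\<in>kl_ball Sh \<epsilon>. norm T \<le> norm S"
    using continuous_attains_sup[OF compact_kl_ball[OF assms]] centre_in_kl_ball[OF assms] by blast
  moreover have "lip_const Sh \<epsilon> = norm S"
    unfolding lip_const_def using S by (intro cSup_eq_maximum) auto
  ultimately show thesis using that by blast
qed

text \<open>A minimiser \<open>T\<close> for \<open>L'\<close> is feasible for \<open>L\<close>, so the value at \<open>L\<close> exceeds the one at
  \<open>L'\<close> by at most \<open>\<langle>L - L', T\<rangle>\<close>, and the roles may be exchanged.\<close>

lemma lipschitz_on_dual_fun:
  assumes "pos_def Sh" "0 \<le> \<epsilon>"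
  shows "(lip_const Sh \<epsilon>)-lipschitz_on X (dual_fun Sh \<epsilon>)"
proof -
  obtain S where "S \<in> kl_ball Sh \<epsilon>" and max: "\<And>T. T \<in> kl_ball Sh \<epsilon> \<Longrightarrow> norm T \<le> norm S"
    and C: "lip_const Sh \<epsilon> = norm S"
    using kl_ball_norm_maximum[OF assms] by blast
  have le: "dual_fun Sh \<epsilon> L - dual_fun Sh \<epsilon> L' \<le> norm S * norm (L - L')" for L L'
  proof -
    obtain T where T: "T \<in> lin_min Sh \<epsilon> L'" using lin_min_nonempty[OF assms] by blast
    then have TB: "T \<in> kl_ball Sh \<epsilon>" by (simp add: lin_min_def is_arg_min_def)
    have "dual_fun Sh \<epsilon> L - dual_fun Sh \<epsilon> L' \<le> (L - L') \<bullet> T"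
      using dual_fun_le[OF assms TB, of L] dual_fun_eq[OF T]
      by (simp add: frob_inner_eq_inner inner_diff_left)
    also have "\<dots> \<le> norm (L - L') * norm T" by (rule norm_cauchy_schwarz)
    also have "\<dots> \<le> norm (L - L') * norm S" by (intro mult_left_mono max TB) simp
    finally show ?thesis by (simp add: mult.commute)
  qed
  show ?thesis
  proof (rule lipschitz_onI)
    fix L L'
    show "dist (dual_fun Sh \<epsilon> L) (dual_fun Sh \<epsilon> L') \<le> lip_const Sh \<epsilon> * dist L L'"
      using le[of L L'] le[of L' L] by (simp add: C dist_norm norm_minus_commute abs_le_iff)
  qed (simp add: C)
qed

text \<open>The constant is attained between \<open>0\<close> and \<open>- S\<close>, where \<open>S\<close> is a point of the ball of
  maximal norm: by Cauchy-Schwarz \<open>S\<close> itself minimises \<open>\<langle>- S, \<cdot>\<rangle>\<close> over the ball, so the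
  dual function falls by \<open>\<parallel>S\<parallel>\<^sup>2\<close> over the distance \<open>\<parallel>S\<parallel>\<close>.\<close>

lemma lip_const_le_lipschitz:
  fixes Sh :: "real^'n^'n"
  assumes Sh: "pos_def Sh" "0 \<le> \<epsilon>"
    and lip: "C-lipschitz_on {L. symmetric_matrix L} (dual_fun Sh \<epsilon>)"
  shows "lip_const Sh \<epsilon> \<le> C"
proof -
  obtain S where S: "S \<in> kl_ball Sh \<epsilon>" and max: "\<And>T. T \<in> kl_ball Sh \<epsilon> \<Longrightarrow> norm T \<le> norm S"
    and lc: "lip_const Sh \<epsilon> = norm S"
    using kl_ball_norm_maximum[OF Sh] by blast
  have Spd: "pos_def S" using S by (simp add: mem_kl_ball)
  then have "S \<noteq> 0"
    by (auto simp: pos_def_iff_pos_semidef_det det_0 simp flip: mat_0)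
  have sym: "symmetric_matrix (- S)" "symmetric_matrix (0 :: real^'n^'n)"
    using Spd by (auto simp: pos_def_def symmetric_matrix_def transpose_def vec_eq_iff)
  have "S \<bullet> T \<le> S \<bullet> S" if "T \<in> kl_ball Sh \<epsilon>" for T
  proof -
    have "S \<bullet> T \<le> norm S * norm T" by (rule norm_cauchy_schwarz)
    also have "\<dots> \<le> norm S * norm S" by (intro mult_left_mono max that) simp
    finally show ?thesis by (simp add: dot_square_norm power2_eq_square)
  qed
  then have "S \<in> lin_min Sh \<epsilon> (- S)"
    using S by (simp add: lin_min_def is_arg_min_linorder frob_inner_eq_inner)
  moreover have "S \<in> lin_min Sh \<epsilon> 0"
    using S by (simp add: lin_min_def is_arg_min_linorder frob_inner_eq_inner)
  ultimately have "dual_fun Sh \<epsilon> (- S) = - (norm S * norm S)" "dual_fun Sh \<epsilon> 0 = 0"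
    by (simp_all add: dual_fun_eq frob_inner_eq_inner dot_square_norm power2_eq_square)
  then have "norm S * norm S \<le> C * norm S"
    using lipschitz_onD[OF lip, of "- S" 0] sym by (simp add: dist_norm)
  then show ?thesis using \<open>S \<noteq> 0\<close> by (simp add: lc)
qed

lemma lip_const_bound:
  fixes Sh :: "real^'n^'n"
  assumes Sh: "pos_def Sh" and \<epsilon>: "0 \<le> \<epsilon>"
  shows "lip_const Sh \<epsilon> \<le> (real CARD('n) * excess_bound \<epsilon> + 1) * norm Sh"
proof -
  obtain S where S: "S \<in> kl_ball Sh \<epsilon>" "lip_const Sh \<epsilon> = norm S"
    using kl_ball_norm_maximum[OF Sh \<epsilon>] by blast
  have "norm S \<le> (1 + excess_bound \<epsilon>) * norm Sh" by (rule norm_le_of_mem_kl_ball[OF Sh \<epsilon> S(1)])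
  also have "\<dots> \<le> (real CARD('n) * excess_bound \<epsilon> + 1) * norm Sh"
  proof (rule mult_right_mono)
    have "1 * excess_bound \<epsilon> \<le> real CARD('n) * excess_bound \<epsilon>"
      using excess_bound_nonneg[OF \<epsilon>] by (intro mult_right_mono) (auto simp: Suc_leI)
    then show "1 + excess_bound \<epsilon> \<le> real CARD('n) * excess_bound \<epsilon> + 1" by simp
  qed simp
  finally show ?thesis by (simp add: S(2))
qed

section \<open>The linear minimization oracle\<close>

theorem proposition3p2:
  fixes Sh :: "real^'n^'n" and \<epsilon> :: real
  assumes "pos_def Sh" and "0 \<le> \<epsilon>"
  shows
    "(\<forall>\<Lambda>. symmetric_matrix \<Lambda> \<and> \<Lambda> \<noteq> 0 \<and> 0 < \<epsilon> \<longrightarrow>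
       (let M = matrix_sqrt Sh ** \<Lambda> ** matrix_sqrt Sh;
            G = {\<gamma>. kl_div (sigma_star Sh \<Lambda> \<gamma>) Sh - ereal \<epsilon> = 0
                    \<and> max 0 (2 * lambda_max (- M)) < \<gamma>
                    \<and> \<gamma> \<le> nuclear_norm M *
                          (sqrt (6 / \<epsilon>) * indicator {0..1/24} \<epsilon>
                           + (6 + 1 / (4 * \<epsilon>)) * indicator {1/24<..} \<epsilon>)}
        in G \<noteq> {} \<and> (\<forall>\<gamma>\<in>G. lin_min Sh \<epsilon> \<Lambda> = {sigma_star Sh \<Lambda> \<gamma>})))
     \<and>
     (\<forall>\<Lambda>. symmetric_matrix \<Lambda> \<longrightarrow> lin_min Sh \<epsilon> \<Lambda> \<noteq> {})
     \<and> (\<exists>S. is_arg_max norm (\<lambda>T. T \<in> kl_ball Sh \<epsilon>) S)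
     \<and> (lip_const Sh \<epsilon>)-lipschitz_on {\<Lambda>. symmetric_matrix \<Lambda>} (dual_fun Sh \<epsilon>)
     \<and> (\<forall>C. C-lipschitz_on {\<Lambda>. symmetric_matrix \<Lambda>} (dual_fun Sh \<epsilon>) \<longrightarrow> lip_const Sh \<epsilon> \<le> C)
     \<and> lip_const Sh \<epsilon> \<le>
         (real CARD('n) * sqrt (6 * \<epsilon>) * indicator {0..1/24} \<epsilon>
          + real CARD('n) * (6 * \<epsilon> + 1/4) * indicator {1/24<..} \<epsilon> + 1) * norm Sh"
proof (intro conjI allI impI)
  fix \<Lambda> :: "real^'n^'n"
  assume \<Lambda>: "symmetric_matrix \<Lambda> \<and> \<Lambda> \<noteq> 0 \<and> 0 < \<epsilon>"
  show "let M = matrix_sqrt Sh ** \<Lambda> ** matrix_sqrt Sh;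
            G = {\<gamma>. kl_div (sigma_star Sh \<Lambda> \<gamma>) Sh - ereal \<epsilon> = 0
                    \<and> max 0 (2 * lambda_max (- M)) < \<gamma>
                    \<and> \<gamma> \<le> nuclear_norm M *
                          (sqrt (6 / \<epsilon>) * indicator {0..1/24} \<epsilon>
                           + (6 + 1 / (4 * \<epsilon>)) * indicator {1/24<..} \<epsilon>)}
        in G \<noteq> {} \<and> (\<forall>\<gamma>\<in>G. lin_min Sh \<epsilon> \<Lambda> = {sigma_star Sh \<Lambda> \<gamma>})"
    using kl_oracle_closed_form[OF assms(1), of \<Lambda> \<epsilon>] \<Lambda>
    unfolding Let_def multiplier_factor_def by blast
next
  show "lin_min Sh \<epsilon> \<Lambda> \<noteq> {}" for \<Lambda> by (rule lin_min_nonempty[OF assms])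
  obtain S where "S \<in> kl_ball Sh \<epsilon>" "\<And>T. T \<in> kl_ball Sh \<epsilon> \<Longrightarrow> norm T \<le> norm S"
    using kl_ball_norm_maximum[OF assms] by blast
  then show "\<exists>S. is_arg_max norm (\<lambda>T. T \<in> kl_ball Sh \<epsilon>) S"
    by (auto simp: is_arg_max_linorder)
  show "(lip_const Sh \<epsilon>)-lipschitz_on {\<Lambda>. symmetric_matrix \<Lambda>} (dual_fun Sh \<epsilon>)"
    by (rule lipschitz_on_dual_fun[OF assms])
  show "lip_const Sh \<epsilon> \<le> C" if "C-lipschitz_on {\<Lambda>. symmetric_matrix \<Lambda>} (dual_fun Sh \<epsilon>)" for C
    by (rule lip_const_le_lipschitz[OF assms that])
  show "lip_const Sh \<epsilon> \<le>
         (real CARD('n) * sqrt (6 * \<epsilon>) * indicator {0..1/24} \<epsilon>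
          + real CARD('n) * (6 * \<epsilon> + 1/4) * indicator {1/24<..} \<epsilon> + 1) * norm Sh"
    using lip_const_bound[OF assms] by (simp add: excess_bound_def algebra_simps)
qed

end
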